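(* Let $A,B$ be commutative rings, $f:A\to B$ a ring homomorphism and $J$ an ideal of $B$ with $J\subseteq\operatorname{Nil}(B)$, regarded as an $A$-module via $f$. Then the ring $A\bowtie^fJ$ is Cohen–Macaulay in the sense of ideals if and only if $A$ is Cohen–Macaulay in the sense of ideals and $\operatorname{Kgrade}_A(\mathfrak a,J)\ge\operatorname{ht}\mathfrak a$ for every ideal $\mathfrak a$ of $A$.
   Context: $\operatorname{Nil}(B)$ is the nilradical. $A\bowtie^fJ=\{(a,f(a)+j): a\in A,\ j\in J\}\subseteq A\times B$. Koszul grade: for a ring $R$, an $R$-module $M$ and a finitely generated ideal $\mathfrak b=(x_1,\dots,x_\ell)$, $\operatorname{Kgrade}_R(\mathfrak b,M)=\inf\{i\ge0: H^i(\operatorname{Hom}_R(\mathbb K_\bullet(x_1,\dots,x_\ell),M))\ne0\}$ ($\inf\emptyset=\infty$), independent of generators; for arbitrary $\mathfrak a$, the sup over finitely generated subideals. $\operatorname{ht}I=\inf\{\dim R_\mathfrak P:\mathfrak P\supseteq I$ prime$\}$. A ring $R$ is Cohen–Macaulay in the sense of ideals if $\operatorname{ht}I=\operatorname{Kgrade}_R(I,R)$ for every ideal $I$ of $R$. *)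

theory Defs
  imports "HOL-Algebra.Module" "HOL-Algebra.Ideal" "HOL-Library.Extended_Nat"
begin

definition nilrad :: "('b, 'c) ring_scheme \<Rightarrow> 'b set" where
  "nilrad B = {x \<in> carrier B. \<exists>n::nat. x [^]\<^bsub>B\<^esub> n = \<zero>\<^bsub>B\<^esub>}"

definition amalg :: "'a ring \<Rightarrow> 'b ring \<Rightarrow> ('a \<Rightarrow> 'b) \<Rightarrow> 'b set \<Rightarrow> ('a \<times> 'b) ring" where
  "amalg A B f J =
     \<lparr> carrier = {(a, f a \<oplus>\<^bsub>B\<^esub> j) | a j. a \<in> carrier A \<and> j \<in> J},
       mult = (\<lambda>x y. (fst x \<otimes>\<^bsub>A\<^esub> fst y, snd x \<otimes>\<^bsub>B\<^esub> snd y)),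
       one = (\<one>\<^bsub>A\<^esub>, \<one>\<^bsub>B\<^esub>),
       zero = (\<zero>\<^bsub>A\<^esub>, \<zero>\<^bsub>B\<^esub>),
       add = (\<lambda>x y. (fst x \<oplus>\<^bsub>A\<^esub> fst y, snd x \<oplus>\<^bsub>B\<^esub> snd y)) \<rparr>"

definition induced_module :: "'b ring \<Rightarrow> ('a \<Rightarrow> 'b) \<Rightarrow> 'b set \<Rightarrow> ('a, 'b) module" where
  "induced_module B f J =
     \<lparr> carrier = J, mult = mult B, one = one B, zero = zero B, add = add B,
       smult = (\<lambda>a j. f a \<otimes>\<^bsub>B\<^esub> j) \<rparr>"

definition self_module :: "'a ring \<Rightarrow> ('a, 'a) module" where
  "self_module R =
     \<lparr> carrier = carrier R, mult = mult R, one = one R, zero = zero R, add = add R,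
       smult = mult R \<rparr>"

text \<open>Hom_R(K_\<bullet>(x_1,...,x_l), M): the i-th term is M^(l choose i), written as
  functions from the i-element subsets S of {0..<l} to M (zero elsewhere);
  c S is the value of the cochain on the basis element e_S.\<close>
definition koszul_cochains :: "('r, 'm) module \<Rightarrow> nat \<Rightarrow> nat \<Rightarrow> (nat set \<Rightarrow> 'm) set" where
  "koszul_cochains M l i =
     {c. (\<forall>S. S \<subseteq> {..<l} \<and> card S = i \<longrightarrow> c S \<in> carrier M) \<and>
         (\<forall>S. \<not> (S \<subseteq> {..<l} \<and> card S = i) \<longrightarrow> c S = \<zero>\<^bsub>M\<^esub>)}"

definition koszul_diff :: "('r, 'm) module \<Rightarrow> 'r list \<Rightarrow> nat \<Rightarrow> (nat set \<Rightarrow> 'm) \<Rightarrow> (nat set \<Rightarrow> 'm)" where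
  "koszul_diff M xs i c =
     (\<lambda>T. if T \<subseteq> {..<length xs} \<and> card T = Suc i
          then (\<Oplus>\<^bsub>M\<^esub>t\<in>T. (if even (card {s \<in> T. s < t})
                              then (xs ! t) \<odot>\<^bsub>M\<^esub> c (T - {t})
                              else \<ominus>\<^bsub>M\<^esub> ((xs ! t) \<odot>\<^bsub>M\<^esub> c (T - {t}))))
          else \<zero>\<^bsub>M\<^esub>)"

definition koszul_H_nonzero :: "('r, 'm) module \<Rightarrow> 'r list \<Rightarrow> nat \<Rightarrow> bool" where
  "koszul_H_nonzero M xs i \<longleftrightarrow>
     (\<exists>c \<in> koszul_cochains M (length xs) i.
        koszul_diff M xs i c = (\<lambda>_. \<zero>\<^bsub>M\<^esub>) \<and>
        (case i of
           0 \<Rightarrow> c \<noteq> (\<lambda>_. \<zero>\<^bsub>M\<^esub>)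
         | Suc j \<Rightarrow> \<not> (\<exists>b \<in> koszul_cochains M (length xs) j. koszul_diff M xs j b = c)))"

text \<open>Koszul grade of the ideal generated by xs on M (inf of the empty set is \<infinity>).\<close>
definition Kgrade_list :: "('r, 'm) module \<Rightarrow> 'r list \<Rightarrow> enat" where
  "Kgrade_list M xs = Inf (enat ` {i. koszul_H_nonzero M xs i})"

text \<open>Koszul grade of an arbitrary ideal: supremum over its finitely generated subideals,
  i.e. over all finite lists of elements of the ideal.\<close>
definition Kgrade :: "('r, 'm) module \<Rightarrow> 'r set \<Rightarrow> enat" where
  "Kgrade M I = Sup (Kgrade_list M ` {xs. set xs \<subseteq> I})"

text \<open>dim R_P, computed as the supremum of lengths of chains of primes of R
  ending at P (primes of R_P correspond to primes of R contained in P).\<close>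
definition local_dim :: "'a ring \<Rightarrow> 'a set \<Rightarrow> enat" where
  "local_dim R P = Sup {enat n | n. \<exists>C :: nat \<Rightarrow> 'a set.
      (\<forall>k\<le>n. primeideal (C k) R) \<and> (\<forall>k<n. C k \<subset> C (Suc k)) \<and> C n = P}"

definition ht :: "'a ring \<Rightarrow> 'a set \<Rightarrow> enat" where
  "ht R I = Inf (local_dim R ` {P. primeideal P R \<and> I \<subseteq> P})"

definition CM_ideals :: "'a ring \<Rightarrow> bool" where
  "CM_ideals R \<longleftrightarrow> (\<forall>I. ideal I R \<longrightarrow> ht R I = Kgrade (self_module R) I)"

end

theory Submission
  imports Defs "HOL-Algebra.QuotRing"
begin

text \<open>
  Write \<open>R\<close> for the amalgamation. The projection \<open>R \<rightarrow> A\<close> is onto with nil kernel, so primes and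
  heights of \<open>R\<close> are those of \<open>A\<close>. It is split by \<open>a \<mapsto> (a, f a)\<close>, and \<open>R\<close> is \<open>A \<oplus> J\<close> as an
  \<open>A\<close>-module. Every ideal \<open>I\<close> of \<open>R\<close> has the same radical as the extension of its image \<open>\<aa>\<close> in
  \<open>A\<close>, and Koszul grade only depends on the radical; hence
  \<open>Kgrade(I, R) = min (Kgrade(\<aa>, A), Kgrade(\<aa>, J))\<close>. The theorem then follows from the inequality
  \<open>Kgrade(\<aa>, A) \<le> ht \<aa>\<close>, valid in every commutative ring: if the prime \<open>p\<close> has height \<open>n\<close>, the
  non-Noetherian form of Kronecker's theorem shows that, locally at \<open>p\<close>, finitely many elements of
  \<open>p\<close> lie in the radical of an ideal generated by \<open>n\<close> elements of \<open>p\<close>, whose \<open>n\<close>-th Koszul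
  cohomology at \<open>p\<close> is nonzero.
\<close>

section \<open>Koszul cochains on finite index sets\<close>

text \<open>Localization at a prime is never formed as a ring. Exactness after inverting a
  multiplicative set S is stated with denominators cleared, so one lemma serves twice: S = {1} gives
  radical invariance of the grade, S = R - p the local argument behind the height bound. The engine
  is the mapping cone. Vanishing up to degree i survives when an element joins the sequence, and
  vanishing in degree i survives when an element in the radical of the others leaves it. Two
  sequences are therefore compared through their concatenation. Systems of parameters, the classical
  source of n elements generating p up to radical, need Noetherian rings; this is why Kronecker's
  theorem enters. The inequality between grade and height is decisive because h = min(a, b) together
  with a \<le> h is equivalent to h = a and h \<le> b: one equation for the amalgamation separates
  into the conditions on \<open>A\<close> and on \<open>J\<close>.\<close>

definition signed :: "('m, 'z) ring_scheme \<Rightarrow> nat \<Rightarrow> 'm \<Rightarrow> 'm" where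
  "signed M n v = (if even n then v else \<ominus>\<^bsub>M\<^esub> v)"

definition below :: "nat set \<Rightarrow> nat \<Rightarrow> nat" where
  "below T t = card {s \<in> T. s < t}"

text \<open>The index \<open>n\<close> is the cohomological degree plus one, so that the cochains of degree \<open>-1\<close>
  are \<open>kcochains M \<Lambda> 0 = {0}\<close> and degree \<open>0\<close> needs no separate treatment.\<close>

definition kcochains :: "('r, 'm, 'z) module_scheme \<Rightarrow> nat set \<Rightarrow> nat \<Rightarrow> (nat set \<Rightarrow> 'm) set" where
  "kcochains M \<Lambda> n =
     {c. \<forall>S. if S \<subseteq> \<Lambda> \<and> Suc (card S) = n then c S \<in> carrier M else c S = \<zero>\<^bsub>M\<^esub>}"

text \<open>The formula fixes no degree and acts on families of mixed degree; on a cochain of one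
  degree it gives the next, because the summands at sets of other sizes vanish. \<open>below\<close>
  supplies the usual Koszul sign, the position of t in T.\<close>

definition kdiff :: "('r, 'm, 'z) module_scheme \<Rightarrow> (nat \<Rightarrow> 'r) \<Rightarrow> nat set \<Rightarrow> (nat set \<Rightarrow> 'm) \<Rightarrow> nat set \<Rightarrow> 'm" where
  "kdiff M x \<Lambda> c =
     (\<lambda>T. if T \<subseteq> \<Lambda> then \<Oplus>\<^bsub>M\<^esub>t\<in>T. signed M (below T t) (x t \<odot>\<^bsub>M\<^esub> c (T - {t})) else \<zero>\<^bsub>M\<^esub>)"

text \<open>Vanishing of the cohomology in degree \<open>i\<close> after localization at the multiplicative set \<open>S\<close>,
  with denominators cleared.\<close>

definition kexact :: "'r set \<Rightarrow> ('r, 'm, 'z) module_scheme \<Rightarrow> (nat \<Rightarrow> 'r) \<Rightarrow> nat set \<Rightarrow> nat \<Rightarrow> bool" where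
  "kexact S M x \<Lambda> i \<longleftrightarrow>
     (\<forall>c \<in> kcochains M \<Lambda> (Suc i). kdiff M x \<Lambda> c = (\<lambda>_. \<zero>\<^bsub>M\<^esub>) \<longrightarrow>
        (\<exists>t\<in>S. \<exists>b \<in> kcochains M \<Lambda> i. kdiff M x \<Lambda> b = (\<lambda>T. t \<odot>\<^bsub>M\<^esub> c T)))"

section \<open>Functoriality of the Koszul differential\<close>

lemma abelian_group_hom_if_additive:
  assumes "abelian_group M" "abelian_group N" "\<And>v. v \<in> carrier M \<Longrightarrow> h v \<in> carrier N"
    and "\<And>v w. v \<in> carrier M \<Longrightarrow> w \<in> carrier M \<Longrightarrow> h (v \<oplus>\<^bsub>M\<^esub> w) = h v \<oplus>\<^bsub>N\<^esub> h w"
  shows "abelian_group_hom M N h"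
  using assms
  by (intro abelian_group_homI group_hom.intro group_hom_axioms.intro)
    (auto simp: hom_def intro: abelian_group.a_group)

lemma (in abelian_group_hom) hom_finsum:
  assumes "g \<in> A \<rightarrow> carrier G"
  shows "h (finsum G g A) = finsum H (\<lambda>a. h (g a)) A"
  using assms
proof (induction A rule: infinite_finite_induct)
  case (insert a A)
  then have "h (g a \<oplus>\<^bsub>G\<^esub> finsum G g A) = h (g a) \<oplus>\<^bsub>H\<^esub> finsum H (\<lambda>a. h (g a)) A"
    by (simp add: Pi_def)
  moreover have "g a \<in> carrier G" "g \<in> A \<rightarrow> carrier G" "(\<lambda>a. h (g a)) \<in> A \<rightarrow> carrier H"
    "h (g a) \<in> carrier H"
    using insert.prems by (auto simp: Pi_def)
  ultimately show ?case
    using insert.hyps by simp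
qed (simp_all add: hom_zero)

text \<open>The sign is applied by the additive inverse and not by the scalar -1, so maps between
  modules over different rings respect it.\<close>

lemma (in abelian_group_hom) hom_signed:
  "v \<in> carrier G \<Longrightarrow> h (signed G n v) = signed H n (h v)"
  by (simp add: signed_def)

text \<open>Compatibility is asked only for the scalars x t and y t, so the two modules need no
  common base ring. This covers multiplication by a scalar as well as the maps between the
  amalgamation, \<open>A\<close> and \<open>J\<close>.\<close>

lemma kdiff_hom:
  assumes "abelian_group_hom M N h"
    and c: "\<And>S. c S \<in> carrier M"
    and x: "\<And>t v. t \<in> \<Lambda> \<Longrightarrow> v \<in> carrier M \<Longrightarrow> x t \<odot>\<^bsub>M\<^esub> v \<in> carrier M"
    and hx: "\<And>t v. t \<in> \<Lambda> \<Longrightarrow> v \<in> carrier M \<Longrightarrow> h (x t \<odot>\<^bsub>M\<^esub> v) = y t \<odot>\<^bsub>N\<^esub> h v"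
  shows "kdiff N y \<Lambda> (\<lambda>S. h (c S)) = (\<lambda>T. h (kdiff M x \<Lambda> c T))"
proof
  fix T
  interpret abelian_group_hom M N h by fact
  show "kdiff N y \<Lambda> (\<lambda>S. h (c S)) T = h (kdiff M x \<Lambda> c T)"
  proof (cases "T \<subseteq> \<Lambda>")
    case True
    have cl: "signed M (below T t) (x t \<odot>\<^bsub>M\<^esub> c (T - {t})) \<in> carrier M" if "t \<in> T" for t
      using that True c x by (auto simp: signed_def)
    have eq: "h (signed M (below T t) (x t \<odot>\<^bsub>M\<^esub> c (T - {t})))
        = signed N (below T t) (y t \<odot>\<^bsub>N\<^esub> h (c (T - {t})))" if "t \<in> T" for t
      using that True c x hx by (subst hom_signed) auto
    have "h (kdiff M x \<Lambda> c T) = (\<Oplus>\<^bsub>N\<^esub>t\<in>T. h (signed M (below T t) (x t \<odot>\<^bsub>M\<^esub> c (T - {t}))))"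
      using True cl by (simp add: kdiff_def hom_finsum Pi_def)
    also have "\<dots> = (\<Oplus>\<^bsub>N\<^esub>t\<in>T. signed N (below T t) (y t \<odot>\<^bsub>N\<^esub> h (c (T - {t}))))"
      using cl eq by (intro H.finsum_cong') (auto simp: Pi_def, metis hom_closed)
    finally show ?thesis
      using True by (simp add: kdiff_def)
  qed (simp add: kdiff_def hom_zero)
qed

context Module.module begin

lemma smult_hom: "r \<in> carrier R \<Longrightarrow> abelian_group_hom M M (\<lambda>v. r \<odot>\<^bsub>M\<^esub> v)"
  by (rule abelian_group_hom_if_additive[OF M.abelian_group_axioms M.abelian_group_axioms])
    (auto simp: smult_r_distr)

lemma signed_closed [simp]: "v \<in> carrier M \<Longrightarrow> signed M n v \<in> carrier M"
  by (simp add: signed_def)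

lemma signed_signed: "v \<in> carrier M \<Longrightarrow> signed M n (signed M m v) = signed M (n + m) v"
  by (simp add: signed_def)

lemma signed_smult:
  "r \<in> carrier R \<Longrightarrow> v \<in> carrier M \<Longrightarrow> r \<odot>\<^bsub>M\<^esub> signed M n v = signed M n (r \<odot>\<^bsub>M\<^esub> v)"
  by (simp add: signed_def smult_r_minus)

lemma signed_zero [simp]: "signed M n \<zero>\<^bsub>M\<^esub> = \<zero>\<^bsub>M\<^esub>"
  by (simp add: signed_def)

lemma signed_add:
  "v \<in> carrier M \<Longrightarrow> w \<in> carrier M \<Longrightarrow>
    signed M n (v \<oplus>\<^bsub>M\<^esub> w) = signed M n v \<oplus>\<^bsub>M\<^esub> signed M n w"
  by (simp add: signed_def M.minus_add)

lemma signed_hom: "abelian_group_hom M M (signed M n)"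
  by (rule abelian_group_hom_if_additive[OF M.abelian_group_axioms M.abelian_group_axioms])
    (auto simp: signed_add)

lemma signed_cong_parity: "even n = even m \<Longrightarrow> signed M n v = signed M m v"
  by (simp add: signed_def)

lemma kcochains_closed: "c \<in> kcochains M \<Lambda> n \<Longrightarrow> c S \<in> carrier M"
  by (simp add: kcochains_def) (metis M.zero_closed)

lemma kcochains_outside: "c \<in> kcochains M \<Lambda> n \<Longrightarrow> \<not> S \<subseteq> \<Lambda> \<Longrightarrow> c S = \<zero>\<^bsub>M\<^esub>"
  by (auto simp: kcochains_def)

lemma kcochains_smult:
  "r \<in> carrier R \<Longrightarrow> c \<in> kcochains M \<Lambda> n \<Longrightarrow> (\<lambda>S. r \<odot>\<^bsub>M\<^esub> c S) \<in> kcochains M \<Lambda> n"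
  by (auto simp: kcochains_def)

lemma kcochains_add:
  "c \<in> kcochains M \<Lambda> n \<Longrightarrow> b \<in> kcochains M \<Lambda> n \<Longrightarrow> (\<lambda>S. c S \<oplus>\<^bsub>M\<^esub> b S) \<in> kcochains M \<Lambda> n"
  by (auto simp: kcochains_def)

lemma kcochains_minus:
  "c \<in> kcochains M \<Lambda> n \<Longrightarrow> b \<in> kcochains M \<Lambda> n \<Longrightarrow> (\<lambda>S. c S \<ominus>\<^bsub>M\<^esub> b S) \<in> kcochains M \<Lambda> n"
  by (auto simp: kcochains_def a_minus_def)

lemma kcochains_0: "kcochains M \<Lambda> 0 = {\<lambda>_. \<zero>\<^bsub>M\<^esub>}"
  by (auto simp: kcochains_def)

lemma zero_kcochain: "(\<lambda>_. \<zero>\<^bsub>M\<^esub>) \<in> kcochains M \<Lambda> n"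
  by (auto simp: kcochains_def)

lemma kdiff_closed:
  assumes "\<And>S. c S \<in> carrier M" "x ` \<Lambda> \<subseteq> carrier R"
  shows "kdiff M x \<Lambda> c T \<in> carrier M"
  using assms by (auto simp: kdiff_def intro!: M.finsum_closed signed_closed smult_closed)

lemma kdiff_smult:
  assumes "r \<in> carrier R" "\<And>S. c S \<in> carrier M" "x ` \<Lambda> \<subseteq> carrier R"
  shows "kdiff M x \<Lambda> (\<lambda>S. r \<odot>\<^bsub>M\<^esub> c S) = (\<lambda>T. r \<odot>\<^bsub>M\<^esub> kdiff M x \<Lambda> c T)"
proof (rule kdiff_hom[OF smult_hom])
  fix t v assume "t \<in> \<Lambda>" "v \<in> carrier M"
  then have "x t \<in> carrier R" using assms by auto
  then show "x t \<odot>\<^bsub>M\<^esub> v \<in> carrier M" "r \<odot>\<^bsub>M\<^esub> (x t \<odot>\<^bsub>M\<^esub> v) = x t \<odot>\<^bsub>M\<^esub> (r \<odot>\<^bsub>M\<^esub> v)"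
    using \<open>v \<in> carrier M\<close> assms by (simp_all flip: smult_assoc1 add: R.m_comm)
qed (use assms in auto)

lemma kdiff_add:
  assumes "\<And>S. c S \<in> carrier M" "\<And>S. b S \<in> carrier M" "x ` \<Lambda> \<subseteq> carrier R"
  shows "kdiff M x \<Lambda> (\<lambda>S. c S \<oplus>\<^bsub>M\<^esub> b S) = (\<lambda>T. kdiff M x \<Lambda> c T \<oplus>\<^bsub>M\<^esub> kdiff M x \<Lambda> b T)"
proof
  fix T
  show "kdiff M x \<Lambda> (\<lambda>S. c S \<oplus>\<^bsub>M\<^esub> b S) T = kdiff M x \<Lambda> c T \<oplus>\<^bsub>M\<^esub> kdiff M x \<Lambda> b T"
  proof (cases "T \<subseteq> \<Lambda>")
    case True
    then have x: "x t \<in> carrier R" if "t \<in> T" for t using that assms(3) by blast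
    let ?s = "\<lambda>c t. signed M (below T t) (x t \<odot>\<^bsub>M\<^esub> c (T - {t}))"
    have "kdiff M x \<Lambda> (\<lambda>S. c S \<oplus>\<^bsub>M\<^esub> b S) T = (\<Oplus>\<^bsub>M\<^esub>t\<in>T. ?s c t \<oplus>\<^bsub>M\<^esub> ?s b t)"
      unfolding kdiff_def if_P[OF True]
      by (rule M.finsum_cong') (use x assms(1,2) in \<open>auto simp: smult_r_distr signed_add\<close>)
    also have "\<dots> = (\<Oplus>\<^bsub>M\<^esub>t\<in>T. ?s c t) \<oplus>\<^bsub>M\<^esub> (\<Oplus>\<^bsub>M\<^esub>t\<in>T. ?s b t)"
      by (rule M.finsum_addf) (use x assms(1,2) in auto)
    finally show ?thesis
      using True by (simp add: kdiff_def)
  qed (simp add: kdiff_def)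
qed

lemma kdiff_minus:
  assumes "\<And>S. c S \<in> carrier M" "\<And>S. b S \<in> carrier M" "x ` \<Lambda> \<subseteq> carrier R"
  shows "kdiff M x \<Lambda> (\<lambda>S. c S \<ominus>\<^bsub>M\<^esub> b S) = (\<lambda>T. kdiff M x \<Lambda> c T \<ominus>\<^bsub>M\<^esub> kdiff M x \<Lambda> b T)"
proof -
  have minus: "v \<ominus>\<^bsub>M\<^esub> w = v \<oplus>\<^bsub>M\<^esub> (\<ominus> \<one>) \<odot>\<^bsub>M\<^esub> w" if "w \<in> carrier M" for v w
    using that by (simp add: a_minus_def smult_l_minus)
  have "kdiff M x \<Lambda> b T \<in> carrier M" for T
    using assms by (intro kdiff_closed)
  then show ?thesis
    using assms by (simp add: minus kdiff_add kdiff_smult)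
qed

lemma kdiff_zero: "x ` \<Lambda> \<subseteq> carrier R \<Longrightarrow> kdiff M x \<Lambda> (\<lambda>_. \<zero>\<^bsub>M\<^esub>) = (\<lambda>_. \<zero>\<^bsub>M\<^esub>)"
  using kdiff_smult[of \<zero> "\<lambda>_. \<zero>\<^bsub>M\<^esub>" x \<Lambda>] kdiff_closed[of "\<lambda>_. \<zero>\<^bsub>M\<^esub>" x \<Lambda>] by simp

end

section \<open>Splitting cochains along one added index\<close>

definition kfun :: "('r, 'm, 'z) module_scheme \<Rightarrow> nat set \<Rightarrow> (nat set \<Rightarrow> 'm) set" where
  "kfun M \<Lambda> = {c. \<forall>S. c S \<in> carrier M \<and> (\<not> S \<subseteq> \<Lambda> \<longrightarrow> c S = \<zero>\<^bsub>M\<^esub>)}"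

text \<open>c0 is the part on sets without p, c1 the part on sets from which p has been removed. The
  sign moves e_p to the front of e_S, so that the differential takes the cone form (d c0, x_p c0 - d
  c1).\<close>

definition kpair :: "('r, 'm, 'z) module_scheme \<Rightarrow> nat \<Rightarrow> (nat set \<Rightarrow> 'm) \<Rightarrow> (nat set \<Rightarrow> 'm) \<Rightarrow> nat set \<Rightarrow> 'm" where
  "kpair M p c0 c1 = (\<lambda>S. if p \<in> S then signed M (below S p) (c1 (S - {p})) else c0 S)"

lemma below_Diff_self: "below (S - {p}) p = below S p"
  unfolding below_def by (rule arg_cong[of _ _ card]) auto

lemma below_insert_self: "below (insert p S) p = below S p"
  unfolding below_def by (rule arg_cong[of _ _ card]) auto

text \<open>Deleting t and then p, or p and then t, differs by one transposition; this is the extra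
  one. If t < p, it sits in the position of p, otherwise in the position of t.\<close>

lemma below_swap_parity:
  assumes "finite U" "p \<notin> U" "t \<in> U"
  shows "even (below (insert p U) t + below (U - {t}) p) \<longleftrightarrow> even (Suc (below U p + below U t))"
proof (cases "t < p")
  case True
  then have "{s \<in> insert p U. s < t} = {s \<in> U. s < t}" "{s \<in> U. s < p} = insert t {s \<in> U - {t}. s < p}"
    using assms by auto
  then have "below (insert p U) t = below U t" "below U p = Suc (below (U - {t}) p)"
    using assms(1) by (simp_all add: below_def)
  then show ?thesis by auto
next
  case False
  then have "p < t" using assms(2,3) by (cases "p = t") auto
  then have "{s \<in> insert p U. s < t} = insert p {s \<in> U. s < t}" "{s \<in> U. s < p} = {s \<in> U - {t}. s < p}"
    using assms by auto
  then have "below (insert p U) t = Suc (below U t)" "below U p = below (U - {t}) p"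
    using assms(1,2) by (simp_all add: below_def)
  then show ?thesis by auto
qed

context Module.module begin

lemma signed_twice: "v \<in> carrier M \<Longrightarrow> signed M n (signed M n v) = v"
  by (simp add: signed_def)

lemma minus_zero: "\<ominus>\<^bsub>M\<^esub> \<zero>\<^bsub>M\<^esub> = \<zero>\<^bsub>M\<^esub>"
  by simp

lemma kcochains_kfun: "c \<in> kcochains M \<Lambda> n \<Longrightarrow> c \<in> kfun M \<Lambda>"
  by (simp add: kfun_def kcochains_closed kcochains_outside)

lemma kfunD: "c \<in> kfun M \<Lambda> \<Longrightarrow> c S \<in> carrier M" "c \<in> kfun M \<Lambda> \<Longrightarrow> \<not> S \<subseteq> \<Lambda> \<Longrightarrow> c S = \<zero>\<^bsub>M\<^esub>"
  by (simp_all add: kfun_def)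

lemma kdiff_kfun: "c \<in> kfun M \<Lambda> \<Longrightarrow> x ` \<Lambda> \<subseteq> carrier R \<Longrightarrow> kdiff M x \<Lambda> c \<in> kfun M \<Lambda>"
  using kdiff_closed[of c x \<Lambda>] by (simp add: kfun_def) (simp add: kdiff_def)

lemma kfun_smult: "c \<in> kfun M \<Lambda> \<Longrightarrow> r \<in> carrier R \<Longrightarrow> (\<lambda>S. r \<odot>\<^bsub>M\<^esub> c S) \<in> kfun M \<Lambda>"
  by (simp add: kfun_def)

lemma kfun_minus: "c \<in> kfun M \<Lambda> \<Longrightarrow> b \<in> kfun M \<Lambda> \<Longrightarrow> (\<lambda>S. c S \<ominus>\<^bsub>M\<^esub> b S) \<in> kfun M \<Lambda>"
  by (simp add: kfun_def a_minus_def)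

lemma zero_kfun: "(\<lambda>_. \<zero>\<^bsub>M\<^esub>) \<in> kfun M \<Lambda>"
  by (simp add: kfun_def)

lemma kpair_kcochain:
  assumes "finite \<Lambda>" "p \<notin> \<Lambda>" "c0 \<in> kcochains M \<Lambda> (Suc i)" "c1 \<in> kcochains M \<Lambda> i"
  shows "kpair M p c0 c1 \<in> kcochains M (insert p \<Lambda>) (Suc i)"
proof -
  have "if S \<subseteq> insert p \<Lambda> \<and> Suc (card S) = Suc i then kpair M p c0 c1 S \<in> carrier M
      else kpair M p c0 c1 S = \<zero>\<^bsub>M\<^esub>" for S
  proof (cases "p \<in> S")
    case True
    have iff: "S \<subseteq> insert p \<Lambda> \<longleftrightarrow> S - {p} \<subseteq> \<Lambda>" by auto
    have card: "Suc (card (S - {p})) = card S" if "S - {p} \<subseteq> \<Lambda>"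
    proof -
      have "finite S" using finite_subset[OF that assms(1)] by simp
      then show ?thesis using True by (rule card_Suc_Diff1)
    qed
    show ?thesis
      using assms(4) True iff card by (auto simp: kpair_def kcochains_def)
  next
    case False
    then have "S \<subseteq> insert p \<Lambda> \<longleftrightarrow> S \<subseteq> \<Lambda>" by auto
    then show ?thesis
      using assms(3) False by (auto simp: kpair_def kcochains_def)
  qed
  then show ?thesis by (simp add: kcochains_def)
qed

lemma kpair_ex:
  assumes "finite \<Lambda>" "p \<notin> \<Lambda>" "c \<in> kcochains M (insert p \<Lambda>) (Suc i)"
  obtains c0 c1 where "c0 \<in> kcochains M \<Lambda> (Suc i)" "c1 \<in> kcochains M \<Lambda> i" "c = kpair M p c0 c1"
proof
  let ?c0 = "\<lambda>S. if p \<in> S then \<zero>\<^bsub>M\<^esub> else c S"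
  \<comment> \<open>Signs are involutions, so the sign inserted by \<open>kpair\<close> is cancelled
    by inserting it here as well.\<close>
  let ?c1 = "\<lambda>S. if p \<in> S then \<zero>\<^bsub>M\<^esub> else signed M (below S p) (c (insert p S))"
  have *: "if S \<subseteq> insert p \<Lambda> \<and> card S = i then c S \<in> carrier M else c S = \<zero>\<^bsub>M\<^esub>" for S
    using assms(3) by (simp add: kcochains_def)
  show "?c0 \<in> kcochains M \<Lambda> (Suc i)"
    using * assms(2) by (auto simp: kcochains_def subset_insert)
  have "if S \<subseteq> \<Lambda> \<and> Suc (card S) = i then ?c1 S \<in> carrier M else ?c1 S = \<zero>\<^bsub>M\<^esub>" for S
  proof (cases "p \<in> S")
    case True
    then show ?thesis using assms(2) by auto
  next
    case False
    then have "insert p S \<subseteq> insert p \<Lambda> \<longleftrightarrow> S \<subseteq> \<Lambda>" by auto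
    moreover have "S \<subseteq> \<Lambda> \<Longrightarrow> card (insert p S) = Suc (card S)"
      using False finite_subset[OF _ assms(1)] by simp
    ultimately show ?thesis
      using False *[of "insert p S"] by auto
  qed
  then show "?c1 \<in> kcochains M \<Lambda> i" by (simp add: kcochains_def)
  have "c S \<in> carrier M" for S using assms(3) by (rule kcochains_closed)
  then show "c = kpair M p ?c0 ?c1"
    by (auto simp: kpair_def fun_eq_iff below_Diff_self signed_twice insert_absorb)
qed

lemma kpair_eqD:
  assumes "p \<notin> \<Lambda>" "c0 \<in> kfun M \<Lambda>" "c1 \<in> kfun M \<Lambda>" "b0 \<in> kfun M \<Lambda>" "b1 \<in> kfun M \<Lambda>"
    and eq: "kpair M p c0 c1 = kpair M p b0 b1"
  shows "c0 = b0" "c1 = b1"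
proof -
  have "c0 S = b0 S \<and> c1 S = b1 S" for S
  proof (cases "p \<in> S")
    case True
    then have "\<not> S \<subseteq> \<Lambda>" using assms(1) by auto
    then show ?thesis using assms(2-5) by (simp add: kfunD)
  next
    case False
    then have "signed M n (c1 S) = signed M n (b1 S)" if "n = below (insert p S) p" for n
      using fun_cong[OF eq, of "insert p S"] that by (simp add: kpair_def)
    then have "c1 S = b1 S"
      using signed_twice[OF kfunD(1)[OF assms(3)]] signed_twice[OF kfunD(1)[OF assms(5)]] by metis
    then show ?thesis
      using fun_cong[OF eq, of S] False by (simp add: kpair_def)
  qed
  then show "c0 = b0" "c1 = b1" by auto
qed

lemma kpair_zero: "kpair M p (\<lambda>_. \<zero>\<^bsub>M\<^esub>) (\<lambda>_. \<zero>\<^bsub>M\<^esub>) = (\<lambda>_. \<zero>\<^bsub>M\<^esub>)"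
  by (auto simp: kpair_def)

lemma kpair_smult:
  "c0 \<in> kfun M \<Lambda> \<Longrightarrow> c1 \<in> kfun M \<Lambda> \<Longrightarrow> r \<in> carrier R \<Longrightarrow>
    (\<lambda>S. r \<odot>\<^bsub>M\<^esub> kpair M p c0 c1 S) = kpair M p (\<lambda>S. r \<odot>\<^bsub>M\<^esub> c0 S) (\<lambda>S. r \<odot>\<^bsub>M\<^esub> c1 S)"
  by (auto simp: kpair_def signed_smult kfunD)

text \<open>The Koszul complex on one more element is the mapping cone of multiplication by it.\<close>

lemma kdiff_kpair:
  assumes "finite \<Lambda>" "p \<notin> \<Lambda>" "x ` insert p \<Lambda> \<subseteq> carrier R" "c0 \<in> kfun M \<Lambda>" "c1 \<in> kfun M \<Lambda>"
  shows "kdiff M x (insert p \<Lambda>) (kpair M p c0 c1)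
    = kpair M p (kdiff M x \<Lambda> c0) (\<lambda>S. x p \<odot>\<^bsub>M\<^esub> c0 S \<ominus>\<^bsub>M\<^esub> kdiff M x \<Lambda> c1 S)"
proof
  fix T
  have xc: "x t \<in> carrier R" if "t \<in> insert p \<Lambda>" for t using that assms(3) by blast
  note cc = kfunD(1)[OF assms(4)] kfunD(1)[OF assms(5)]
  show "kdiff M x (insert p \<Lambda>) (kpair M p c0 c1) T
    = kpair M p (kdiff M x \<Lambda> c0) (\<lambda>S. x p \<odot>\<^bsub>M\<^esub> c0 S \<ominus>\<^bsub>M\<^esub> kdiff M x \<Lambda> c1 S) T"
  proof (cases "T \<subseteq> insert p \<Lambda>")
    case False
    then have "\<not> T - {p} \<subseteq> \<Lambda>" "\<not> T \<subseteq> \<Lambda>" by auto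
    then show ?thesis
      using False kfunD(2)[OF assms(4)] xc[of p]
      by (simp add: kdiff_def kpair_def a_minus_def minus_zero)
  next
    case T: True
    show ?thesis
    proof (cases "p \<in> T")
      case False
      then have "T \<subseteq> \<Lambda>" using T by auto
      then show ?thesis
        using False T by (simp add: kdiff_def kpair_def)
    next
      case True
      define U where "U = T - {p}"
      define n where "n = below U p"
      have U: "T = insert p U" "p \<notin> U" "U \<subseteq> \<Lambda>"
        using True T by (auto simp: U_def)
      have finU: "finite U"
        using U(3) assms(1) by (rule finite_subset)
      have xU: "x t \<in> carrier R" if "t \<in> U" for t using that U xc by blast
      \<comment> \<open>Relative to the sign at p, each term with t \<noteq> p carries one
        transposition; it becomes the minus in front of d c1.\<close>
      have summand: "signed M (below T t) (x t \<odot>\<^bsub>M\<^esub> kpair M p c0 c1 (T - {t}))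
        = signed M (Suc n) (signed M (below U t) (x t \<odot>\<^bsub>M\<^esub> c1 (U - {t})))" if "t \<in> U" for t
      proof -
        have "t \<noteq> p" using that U by auto
        then have e: "T - {t} - {p} = U - {t}" "p \<in> T - {t}"
          using True unfolding U_def by auto
        have b: "below (T - {t}) p = below (U - {t}) p"
          unfolding e(1)[symmetric] by (rule below_Diff_self[symmetric])
        have "signed M (below T t) (x t \<odot>\<^bsub>M\<^esub> kpair M p c0 c1 (T - {t}))
            = signed M (below T t + below (U - {t}) p) (x t \<odot>\<^bsub>M\<^esub> c1 (U - {t}))"
          using that xU cc e b by (simp add: kpair_def signed_smult signed_signed)
        also have "\<dots> = signed M (Suc (n + below U t)) (x t \<odot>\<^bsub>M\<^esub> c1 (U - {t}))"
          using below_swap_parity[OF finU U(2) that] unfolding U(1) n_def by (intro signed_cong_parity)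
        finally show ?thesis
          using that xU cc by (simp add: signed_signed)
      qed
      have "kdiff M x (insert p \<Lambda>) (kpair M p c0 c1) T
        = signed M (below T p) (x p \<odot>\<^bsub>M\<^esub> kpair M p c0 c1 (T - {p}))
          \<oplus>\<^bsub>M\<^esub> (\<Oplus>\<^bsub>M\<^esub>t\<in>U. signed M (below T t) (x t \<odot>\<^bsub>M\<^esub> kpair M p c0 c1 (T - {t})))"
      proof -
        have "kpair M p c0 c1 S \<in> carrier M" for S using cc by (simp add: kpair_def)
        then show ?thesis
          using T U finU xc xU by (simp add: kdiff_def Pi_def)
      qed
      also have "(\<Oplus>\<^bsub>M\<^esub>t\<in>U. signed M (below T t) (x t \<odot>\<^bsub>M\<^esub> kpair M p c0 c1 (T - {t})))
        = (\<Oplus>\<^bsub>M\<^esub>t\<in>U. signed M (Suc n) (signed M (below U t) (x t \<odot>\<^bsub>M\<^esub> c1 (U - {t}))))"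
        using summand xU cc by (intro M.finsum_cong') auto
      also have "\<dots> = signed M (Suc n) (kdiff M x \<Lambda> c1 U)"
        using xU cc U(3)
        by (subst abelian_group_hom.hom_finsum[OF signed_hom, symmetric]) (auto simp: kdiff_def)
      also have "kpair M p c0 c1 (T - {p}) = c0 U"
        by (simp add: kpair_def U_def)
      also have "below T p = n"
        by (simp add: U(1) n_def below_insert_self)
      also have "signed M n (x p \<odot>\<^bsub>M\<^esub> c0 U) \<oplus>\<^bsub>M\<^esub> signed M (Suc n) (kdiff M x \<Lambda> c1 U)
        = signed M n (x p \<odot>\<^bsub>M\<^esub> c0 U \<ominus>\<^bsub>M\<^esub> kdiff M x \<Lambda> c1 U)"
        using xc[of p] cc kdiff_closed[of c1 x \<Lambda> U] assms(3)
        by (auto simp: signed_def a_minus_def M.minus_add)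
      also have "\<dots> = kpair M p (kdiff M x \<Lambda> c0) (\<lambda>S. x p \<odot>\<^bsub>M\<^esub> c0 S \<ominus>\<^bsub>M\<^esub> kdiff M x \<Lambda> c1 S) T"
        using True by (simp add: kpair_def U_def n_def below_Diff_self)
      finally show ?thesis .
    qed
  qed
qed

end

section \<open>Invariance of Koszul grade under radicals\<close>

lemma below_image:
  assumes "strict_mono h"
  shows "below (h ` T) (h t) = below T t"
proof -
  have "{s \<in> h ` T. s < h t} = h ` {s \<in> T. s < t}"
    using assms by (auto simp: strict_mono_less)
  then show ?thesis
    unfolding below_def using assms
    by (simp add: card_image strict_mono_imp_inj_on inj_on_subset[OF _ subset_UNIV])
qed

lemma (in cring) ideal_if_closed:
  assumes "I \<subseteq> carrier R" "\<zero> \<in> I" "\<And>a b. a \<in> I \<Longrightarrow> b \<in> I \<Longrightarrow> a \<oplus> b \<in> I"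
    and mult: "\<And>a r. a \<in> I \<Longrightarrow> r \<in> carrier R \<Longrightarrow> r \<otimes> a \<in> I"
  shows "ideal I R"
proof (rule idealI[OF ring_axioms])
  show "subgroup I (add_monoid R)"
  proof (rule add.subgroupI)
    fix a assume "a \<in> I"
    then have "\<ominus> a = \<ominus> \<one> \<otimes> a" using assms(1) by (auto simp: l_minus)
    then show "\<ominus> a \<in> I" using mult[OF \<open>a \<in> I\<close>] by simp
  qed (use assms in auto)
  show "a \<otimes> r \<in> I" if "a \<in> I" "r \<in> carrier R" for a r
    using mult[OF that] that assms(1) by (simp add: m_comm subset_iff)
qed (use mult in auto)

context Module.module begin

lemma minus_eq_zero_iff: "v \<in> carrier M \<Longrightarrow> w \<in> carrier M \<Longrightarrow> v \<ominus>\<^bsub>M\<^esub> w = \<zero>\<^bsub>M\<^esub> \<longleftrightarrow> v = w"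
  unfolding a_minus_def by (metis M.minus_equality M.minus_minus M.r_neg M.a_inv_closed)

lemma minus_self: "v \<in> carrier M \<Longrightarrow> v \<ominus>\<^bsub>M\<^esub> v = \<zero>\<^bsub>M\<^esub>"
  by (simp add: a_minus_def M.r_neg)

text \<open>Signs count predecessors, so the index map has to preserve the order; strict
  monotonicity leaves every sign unchanged.\<close>

lemma kdiff_reindex:
  assumes h: "strict_mono h" and c: "\<And>S. c S \<in> carrier M"
    and x: "\<And>t. t \<in> \<Lambda> \<Longrightarrow> x t = y (h t)" "x ` \<Lambda> \<subseteq> carrier R"
  shows "kdiff M x \<Lambda> (\<lambda>S. c (h ` S)) T = kdiff M y (h ` \<Lambda>) c (h ` T)"
proof (cases "T \<subseteq> \<Lambda>")
  case True
  have inj: "inj h" using h by (rule strict_mono_imp_inj_on)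
  have xT: "x t \<in> carrier R" "y (h t) = x t" if "t \<in> T" for t
    using that True x by auto
  have "kdiff M y (h ` \<Lambda>) c (h ` T)
      = (\<Oplus>\<^bsub>M\<^esub>t\<in>h ` T. signed M (below (h ` T) t) (y t \<odot>\<^bsub>M\<^esub> c (h ` T - {t})))"
    using True by (simp add: kdiff_def image_mono)
  also have "\<dots> = (\<Oplus>\<^bsub>M\<^esub>t\<in>T. signed M (below (h ` T) (h t)) (y (h t) \<odot>\<^bsub>M\<^esub> c (h ` T - {h t})))"
    using xT c inj by (intro M.finsum_reindex) (auto intro: inj_on_subset)
  also have "\<dots> = (\<Oplus>\<^bsub>M\<^esub>t\<in>T. signed M (below T t) (x t \<odot>\<^bsub>M\<^esub> c (h ` (T - {t}))))"
    using xT c inj by (intro M.finsum_cong') (auto simp: below_image[OF h] image_set_diff)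
  finally show ?thesis
    using True by (simp add: kdiff_def)
next
  case False
  then have "\<not> h ` T \<subseteq> h ` \<Lambda>"
    using strict_mono_imp_inj_on[OF h] by (simp add: inj_image_subset_iff)
  with False show ?thesis by (simp add: kdiff_def)
qed

text \<open>Needed because the tail of a concatenated list sits on indices l, l + 1, ..., whereas
  the complex of a list is indexed from 0.\<close>

lemma kexact_reindex:
  assumes h: "strict_mono h" and x: "\<And>t. t \<in> \<Lambda> \<Longrightarrow> x t = y (h t)" "x ` \<Lambda> \<subseteq> carrier R"
    and ex: "kexact S M y (h ` \<Lambda>) i"
  shows "kexact S M x \<Lambda> i"
  unfolding kexact_def
proof (intro ballI impI)
  fix c assume c: "c \<in> kcochains M \<Lambda> (Suc i)" and cocycle: "kdiff M x \<Lambda> c = (\<lambda>_. \<zero>\<^bsub>M\<^esub>)"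
  have inj: "inj h" using h by (rule strict_mono_imp_inj_on)
  have sub: "h ` T \<subseteq> h ` \<Lambda> \<longleftrightarrow> T \<subseteq> \<Lambda>" for T using inj by (rule inj_image_subset_iff)
  have card: "card (h ` T) = card T" for T using inj by (simp add: card_image inj_on_subset)
  \<comment> \<open>The preimage forgets elements that h does not hit, so sets not inside the image
    are sent to zero explicitly.\<close>
  define c' where "c' = (\<lambda>T. if T \<subseteq> h ` \<Lambda> then c (h -` T) else \<zero>\<^bsub>M\<^esub>)"
  have c'h: "c' (h ` T) = c T" for T
    using sub kcochains_outside[OF c] inj by (simp add: c'_def inj_vimage_image_eq)
  have c': "c' \<in> kcochains M (h ` \<Lambda>) (Suc i)"
    unfolding kcochains_def
  proof (clarify, goal_cases)
    case (1 T)
    show ?case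
    proof (cases "T \<subseteq> h ` \<Lambda>")
      case True
      then obtain U where U: "T = h ` U" "U \<subseteq> \<Lambda>" by (auto simp: subset_image_iff)
      then show ?thesis
        using c c'h[of U] by (simp add: kcochains_def card sub)
    qed (simp add: c'_def)
  qed
  have "kdiff M y (h ` \<Lambda>) c' T = \<zero>\<^bsub>M\<^esub>" for T
  proof (cases "T \<subseteq> h ` \<Lambda>")
    case True
    then obtain U where U: "T = h ` U" by (auto simp: subset_image_iff)
    show ?thesis
      using kdiff_reindex[where c = c' and T = U, OF h kcochains_closed[OF c'] x] U cocycle by (simp add: c'h)
  qed (simp add: kdiff_def)
  then have "kdiff M y (h ` \<Lambda>) c' = (\<lambda>_. \<zero>\<^bsub>M\<^esub>)" by blast
  with c' obtain t b where t: "t \<in> S" and b: "b \<in> kcochains M (h ` \<Lambda>) i"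
    and tb: "kdiff M y (h ` \<Lambda>) b = (\<lambda>T. t \<odot>\<^bsub>M\<^esub> c' T)"
    using ex unfolding kexact_def by blast
  have "(\<lambda>T. b (h ` T)) \<in> kcochains M \<Lambda> i"
    using b unfolding kcochains_def by (auto simp: sub card)
  moreover have "kdiff M x \<Lambda> (\<lambda>T. b (h ` T)) = (\<lambda>T. t \<odot>\<^bsub>M\<^esub> c T)"
    using kdiff_reindex[where c = b, OF h kcochains_closed[OF b] x] by (auto simp: tb c'h)
  ultimately show "\<exists>t\<in>S. \<exists>b \<in> kcochains M \<Lambda> i. kdiff M x \<Lambda> b = (\<lambda>T. t \<odot>\<^bsub>M\<^esub> c T)"
    using t by blast
qed

section \<open>Exactness when an element joins or leaves the sequence\<close>

lemma kcocycle_kpairD: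
  assumes "finite \<Lambda>" "p \<notin> \<Lambda>" "x ` insert p \<Lambda> \<subseteq> carrier R"
    and c: "c0 \<in> kfun M \<Lambda>" "c1 \<in> kfun M \<Lambda>"
    and z: "kdiff M x (insert p \<Lambda>) (kpair M p c0 c1) = (\<lambda>_. \<zero>\<^bsub>M\<^esub>)"
  shows "kdiff M x \<Lambda> c0 = (\<lambda>_. \<zero>\<^bsub>M\<^esub>)" "kdiff M x \<Lambda> c1 = (\<lambda>S. x p \<odot>\<^bsub>M\<^esub> c0 S)"
proof -
  have x: "x p \<in> carrier R" "x ` \<Lambda> \<subseteq> carrier R" using assms(3) by auto
  note eqs = kpair_eqD[OF assms(2) kdiff_kfun[OF c(1) x(2)] kfun_minus[OF kfun_smult[OF c(1) x(1)] kdiff_kfun[OF c(2) x(2)]] zero_kfun zero_kfun,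
        OF trans[OF kdiff_kpair[OF assms(1-3) c, symmetric] trans[OF z kpair_zero[symmetric]]]]
  show "kdiff M x \<Lambda> c0 = (\<lambda>_. \<zero>\<^bsub>M\<^esub>)" by (rule eqs(1))
  show "kdiff M x \<Lambda> c1 = (\<lambda>S. x p \<odot>\<^bsub>M\<^esub> c0 S)"
  proof
    fix S
    have cl: "kdiff M x \<Lambda> c1 S \<in> carrier M" "x p \<odot>\<^bsub>M\<^esub> c0 S \<in> carrier M"
      using kfunD(1)[OF kdiff_kfun[OF c(2) x(2)]] kfunD(1)[OF c(1)] x by auto
    have "x p \<odot>\<^bsub>M\<^esub> c0 S \<ominus>\<^bsub>M\<^esub> kdiff M x \<Lambda> c1 S = \<zero>\<^bsub>M\<^esub>" using fun_cong[OF eqs(2)] by simp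
    then show "kdiff M x \<Lambda> c1 S = x p \<odot>\<^bsub>M\<^esub> c0 S"
      using cl by (simp add: minus_eq_zero_iff)
  qed
qed

text \<open>This is the long exact sequence of the cone: the cohomology of the larger complex in
  degree i lies between that of the smaller one in degrees i and i - 1. The proof exhibits the bound
  explicitly, which keeps track of the denominators s and t.\<close>

lemma kexact_insert:
  assumes fin: "finite \<Lambda>" "p \<notin> \<Lambda>" "x ` insert p \<Lambda> \<subseteq> carrier R"
    and S: "S \<subseteq> carrier R" "\<And>s t. s \<in> S \<Longrightarrow> t \<in> S \<Longrightarrow> s \<otimes> t \<in> S"
    and ex: "\<And>j. j \<le> i \<Longrightarrow> kexact S M x \<Lambda> j"
  shows "kexact S M x (insert p \<Lambda>) i"
  unfolding kexact_def
proof (intro ballI impI)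
  fix c assume c: "c \<in> kcochains M (insert p \<Lambda>) (Suc i)"
    and cocycle: "kdiff M x (insert p \<Lambda>) c = (\<lambda>_. \<zero>\<^bsub>M\<^esub>)"
  have x: "x p \<in> carrier R" "x ` \<Lambda> \<subseteq> carrier R" using fin(3) by auto
  obtain c0 c1 where c0: "c0 \<in> kcochains M \<Lambda> (Suc i)" and c1: "c1 \<in> kcochains M \<Lambda> i"
    and cc: "c = kpair M p c0 c1"
    using kpair_ex[OF fin(1,2) c] .
  note f0 = kcochains_kfun[OF c0] and f1 = kcochains_kfun[OF c1]
  note d = kcocycle_kpairD[OF fin f0 f1 cocycle[unfolded cc]]
  obtain t b0 where t: "t \<in> S" and b0: "b0 \<in> kcochains M \<Lambda> i"
    and tb0: "kdiff M x \<Lambda> b0 = (\<lambda>T. t \<odot>\<^bsub>M\<^esub> c0 T)"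
    using ex[of i] c0 d(1) unfolding kexact_def by blast
  have tR: "t \<in> carrier R" using t S by auto
  note g0 = kcochains_kfun[OF b0]
  show "\<exists>t\<in>S. \<exists>b \<in> kcochains M (insert p \<Lambda>) i. kdiff M x (insert p \<Lambda>) b = (\<lambda>T. t \<odot>\<^bsub>M\<^esub> c T)"
  proof (cases i)
    case 0
    \<comment> \<open>In degree 0 the components c1 and b0 have degree -1 and vanish, so t kills c
      and the zero cochain bounds.\<close>
    have z: "c1 = (\<lambda>_. \<zero>\<^bsub>M\<^esub>)" "b0 = (\<lambda>_. \<zero>\<^bsub>M\<^esub>)"
      using c1 b0 0 by (simp_all add: kcochains_0)
    have "(\<lambda>T. t \<odot>\<^bsub>M\<^esub> c T) = kpair M p (\<lambda>T. t \<odot>\<^bsub>M\<^esub> c0 T) (\<lambda>T. t \<odot>\<^bsub>M\<^esub> c1 T)"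
      unfolding cc using f0 f1 tR by (rule kpair_smult)
    also have "\<dots> = (\<lambda>_. \<zero>\<^bsub>M\<^esub>)"
      unfolding tb0[symmetric] z using tR by (simp add: kdiff_zero[OF x(2)] kpair_zero)
    finally have "kdiff M x (insert p \<Lambda>) (\<lambda>_. \<zero>\<^bsub>M\<^esub>) = (\<lambda>T. t \<odot>\<^bsub>M\<^esub> c T)"
      using kdiff_zero[OF fin(3)] by simp
    then show ?thesis using t zero_kcochain by blast
  next
    case (Suc j)
    \<comment> \<open>The error x_p b0 - t c1 is a cocycle one degree lower; after a further factor
      s it equals d b1, and the pair (s b0, b1) bounds s t c.\<close>
    let ?e = "\<lambda>S. x p \<odot>\<^bsub>M\<^esub> b0 S \<ominus>\<^bsub>M\<^esub> t \<odot>\<^bsub>M\<^esub> c1 S"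
    have e: "?e \<in> kcochains M \<Lambda> (Suc j)"
      using b0 c1 x(1) tR unfolding Suc by (intro kcochains_minus kcochains_smult)
    have "kdiff M x \<Lambda> ?e = (\<lambda>S. x p \<odot>\<^bsub>M\<^esub> (t \<odot>\<^bsub>M\<^esub> c0 S) \<ominus>\<^bsub>M\<^esub> t \<odot>\<^bsub>M\<^esub> (x p \<odot>\<^bsub>M\<^esub> c0 S))"
      using x tR kfunD(1)[OF g0] kfunD(1)[OF f1]
      by (subst kdiff_minus) (auto simp: kdiff_smult tb0 d(2))
    also have "\<dots> = (\<lambda>_. \<zero>\<^bsub>M\<^esub>)"
      using x tR kfunD(1)[OF f0]
      by (simp add: smult_assoc1[symmetric] R.m_comm[of t "x p"] minus_self)
    finally obtain s b1 where s: "s \<in> S" and b1: "b1 \<in> kcochains M \<Lambda> j"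
      and sb1: "kdiff M x \<Lambda> b1 = (\<lambda>T. s \<odot>\<^bsub>M\<^esub> ?e T)"
      using ex[of j] e Suc unfolding kexact_def by auto
    have sR: "s \<in> carrier R" using s S by auto
    note g1 = kcochains_kfun[OF b1]
    have "kpair M p (\<lambda>T. s \<odot>\<^bsub>M\<^esub> b0 T) b1 \<in> kcochains M (insert p \<Lambda>) i"
      unfolding Suc using fin b1 kcochains_smult[OF sR b0[unfolded Suc]] by (intro kpair_kcochain)
    moreover have "kdiff M x (insert p \<Lambda>) (kpair M p (\<lambda>T. s \<odot>\<^bsub>M\<^esub> b0 T) b1) = (\<lambda>T. (s \<otimes> t) \<odot>\<^bsub>M\<^esub> c T)"
    proof -
      have snd: "x p \<odot>\<^bsub>M\<^esub> (s \<odot>\<^bsub>M\<^esub> b0 T) \<ominus>\<^bsub>M\<^esub> s \<odot>\<^bsub>M\<^esub> ?e T = (s \<otimes> t) \<odot>\<^bsub>M\<^esub> c1 T" for T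
      proof -
        define u v where "u = s \<odot>\<^bsub>M\<^esub> (x p \<odot>\<^bsub>M\<^esub> b0 T)" and "v = s \<odot>\<^bsub>M\<^esub> (t \<odot>\<^bsub>M\<^esub> c1 T)"
        have cl: "u \<in> carrier M" "v \<in> carrier M"
          using x tR sR kfunD(1)[OF g0] kfunD(1)[OF f1] by (auto simp: u_def v_def)
        have "x p \<odot>\<^bsub>M\<^esub> (s \<odot>\<^bsub>M\<^esub> b0 T) = u"
          using x sR kfunD(1)[OF g0] by (simp add: u_def smult_assoc1[symmetric] R.m_comm)
        moreover have "s \<odot>\<^bsub>M\<^esub> ?e T = u \<ominus>\<^bsub>M\<^esub> v"
          using x tR sR kfunD(1)[OF g0] kfunD(1)[OF f1]
          by (simp add: u_def v_def a_minus_def smult_r_distr smult_r_minus)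
        moreover have "u \<ominus>\<^bsub>M\<^esub> (u \<ominus>\<^bsub>M\<^esub> v) = v"
          using cl by (simp add: a_minus_def M.minus_add M.r_neg1 M.a_assoc[symmetric] M.r_neg)
        moreover have "v = (s \<otimes> t) \<odot>\<^bsub>M\<^esub> c1 T"
          using tR sR kfunD(1)[OF f1] by (simp add: v_def smult_assoc1)
        ultimately show ?thesis by simp
      qed
      have "kdiff M x (insert p \<Lambda>) (kpair M p (\<lambda>T. s \<odot>\<^bsub>M\<^esub> b0 T) b1)
         = kpair M p (\<lambda>T. (s \<otimes> t) \<odot>\<^bsub>M\<^esub> c0 T) (\<lambda>T. (s \<otimes> t) \<odot>\<^bsub>M\<^esub> c1 T)"
        unfolding kdiff_kpair[OF fin kfun_smult[OF g0 sR] g1] sb1 snd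
        using sR tR x kfunD(1)[OF g0] kfunD(1)[OF f0] by (simp add: kdiff_smult tb0 smult_assoc1)
      then show ?thesis
        unfolding cc using kpair_smult[OF f0 f1, of "s \<otimes> t" p] sR tR by simp
    qed
    ultimately show ?thesis using S(2)[OF s t] by blast
  qed
qed

text \<open>Contraction with e_p is a homotopy between multiplication by x_p and zero. In the
  splitting it sends (c0, c1) to (c1, 0), whose differential is (d c1, x_p c1) = (x_p c0, x_p c1)
  for a cocycle.\<close>

lemma koszul_annihilates:
  assumes "finite \<Lambda>" "p \<in> \<Lambda>" "x ` \<Lambda> \<subseteq> carrier R"
    and c: "c \<in> kcochains M \<Lambda> (Suc i)" "kdiff M x \<Lambda> c = (\<lambda>_. \<zero>\<^bsub>M\<^esub>)"
  shows "\<exists>b \<in> kcochains M \<Lambda> i. kdiff M x \<Lambda> b = (\<lambda>T. x p \<odot>\<^bsub>M\<^esub> c T)"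
proof -
  define \<Lambda>' where "\<Lambda>' = \<Lambda> - {p}"
  have L: "\<Lambda> = insert p \<Lambda>'" and fin: "finite \<Lambda>'" "p \<notin> \<Lambda>'" "x ` insert p \<Lambda>' \<subseteq> carrier R"
    using assms by (auto simp: \<Lambda>'_def)
  have x: "x p \<in> carrier R" "x ` \<Lambda>' \<subseteq> carrier R" using fin(3) by auto
  obtain c0 c1 where c0: "c0 \<in> kcochains M \<Lambda>' (Suc i)" and c1: "c1 \<in> kcochains M \<Lambda>' i"
    and cc: "c = kpair M p c0 c1"
    using kpair_ex[OF fin(1,2) c(1)[unfolded L]] .
  note f0 = kcochains_kfun[OF c0] and f1 = kcochains_kfun[OF c1]
  note d = kcocycle_kpairD[OF fin f0 f1 c(2)[unfolded cc L]]
  let ?b = "kpair M p c1 (\<lambda>_. \<zero>\<^bsub>M\<^esub>)"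
  have "?b \<in> kcochains M \<Lambda> i"
  proof (cases i)
    case 0
    then show ?thesis using c1 by (simp add: kcochains_0 kpair_zero)
  next
    case (Suc j)
    then show ?thesis
      unfolding L using c1 zero_kcochain fin by (auto intro: kpair_kcochain)
  qed
  moreover have "kdiff M x \<Lambda> ?b = (\<lambda>T. x p \<odot>\<^bsub>M\<^esub> c T)"
  proof -
    have "kdiff M x \<Lambda> ?b = kpair M p (\<lambda>S. x p \<odot>\<^bsub>M\<^esub> c0 S) (\<lambda>S. x p \<odot>\<^bsub>M\<^esub> c1 S)"
      unfolding L kdiff_kpair[OF fin f1 zero_kfun] d(2) kdiff_zero[OF x(2)]
      using x kfunD(1)[OF f1] by (simp add: a_minus_def minus_zero)
    then show ?thesis
      unfolding cc using kpair_smult[OF f0 f1 x(1), of p] by simp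
  qed
  ultimately show ?thesis by blast
qed

text \<open>For a cocycle c this set is the annihilator of its cohomology class. Being an ideal, it
  contains the ideal generated by the sequence as soon as it contains each member.\<close>

lemma kboundary_ideal:
  assumes x: "x ` \<Lambda> \<subseteq> carrier R" and c: "c \<in> kcochains M \<Lambda> (Suc i)"
  shows "ideal {r \<in> carrier R. \<exists>b \<in> kcochains M \<Lambda> i. kdiff M x \<Lambda> b = (\<lambda>T. r \<odot>\<^bsub>M\<^esub> c T)} R"
    (is "ideal ?I R")
proof (rule R.ideal_if_closed)
  note cc = kcochains_closed[OF c]
  show "?I \<subseteq> carrier R" by auto
  have "kdiff M x \<Lambda> (\<lambda>_. \<zero>\<^bsub>M\<^esub>) = (\<lambda>T. \<zero> \<odot>\<^bsub>M\<^esub> c T)"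
    using kdiff_zero[OF x] cc by simp
  then show "\<zero> \<in> ?I" using zero_kcochain by blast
next
  note cc = kcochains_closed[OF c]
  fix r s assume "r \<in> ?I" "s \<in> ?I"
  then obtain b d where r: "r \<in> carrier R" "s \<in> carrier R"
    and b: "b \<in> kcochains M \<Lambda> i" "kdiff M x \<Lambda> b = (\<lambda>T. r \<odot>\<^bsub>M\<^esub> c T)"
    and d: "d \<in> kcochains M \<Lambda> i" "kdiff M x \<Lambda> d = (\<lambda>T. s \<odot>\<^bsub>M\<^esub> c T)" by auto
  have "kdiff M x \<Lambda> (\<lambda>T. b T \<oplus>\<^bsub>M\<^esub> d T) = (\<lambda>T. (r \<oplus> s) \<odot>\<^bsub>M\<^esub> c T)"
    unfolding kdiff_add[OF kcochains_closed[OF b(1)] kcochains_closed[OF d(1)] x] b(2) d(2)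
    using r cc by (simp add: smult_l_distr)
  then show "r \<oplus> s \<in> ?I"
    using r kcochains_add[OF b(1) d(1)] by blast
next
  note cc = kcochains_closed[OF c]
  fix r s assume "r \<in> ?I" "s \<in> carrier R"
  then obtain b where r: "r \<in> carrier R" "s \<in> carrier R"
    and b: "b \<in> kcochains M \<Lambda> i" "kdiff M x \<Lambda> b = (\<lambda>T. r \<odot>\<^bsub>M\<^esub> c T)" by auto
  have "kdiff M x \<Lambda> (\<lambda>T. s \<odot>\<^bsub>M\<^esub> b T) = (\<lambda>T. (s \<otimes> r) \<odot>\<^bsub>M\<^esub> c T)"
    unfolding kdiff_smult[OF r(2) kcochains_closed[OF b(1)] x] b(2)
    using r cc by (simp add: smult_assoc1)
  then show "s \<otimes> r \<in> ?I"
    using r kcochains_smult[OF r(2) b(1)] by blast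
qed

text \<open>The class of c is killed by the ideal of the sequence, hence by some t x_p^n. The
  exponent is then lowered by one at a time: if t x_p^(m+1) c = d c1, the pair (t x_p^m c, c1) is a
  cocycle of the enlarged complex, and the first component of a bound for s times it bounds s t
  x_p^m c. At exponent 0 a member of S kills the class.\<close>

lemma kexact_radical:
  assumes fin: "finite \<Lambda>" "p \<notin> \<Lambda>" "x ` insert p \<Lambda> \<subseteq> carrier R"
    and S: "S \<subseteq> carrier R" "\<And>s t. s \<in> S \<Longrightarrow> t \<in> S \<Longrightarrow> s \<otimes> t \<in> S"
    and t: "t \<in> S" "t \<otimes> x p [^] (n::nat) \<in> Idl (x ` \<Lambda>)"
    and ex: "kexact S M x (insert p \<Lambda>) i"
  shows "kexact S M x \<Lambda> i"
  unfolding kexact_def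
proof (intro ballI impI)
  fix c assume c: "c \<in> kcochains M \<Lambda> (Suc i)" and cocycle: "kdiff M x \<Lambda> c = (\<lambda>_. \<zero>\<^bsub>M\<^esub>)"
  have x: "x p \<in> carrier R" "x ` \<Lambda> \<subseteq> carrier R" using fin(3) by auto
  note cc = kcochains_closed[OF c]
  define B where "B = {r \<in> carrier R. \<exists>b \<in> kcochains M \<Lambda> i. kdiff M x \<Lambda> b = (\<lambda>T. r \<odot>\<^bsub>M\<^esub> c T)}"
  have "ideal B R" unfolding B_def using x(2) c by (rule kboundary_ideal)
  moreover have "x ` \<Lambda> \<subseteq> B"
    using koszul_annihilates[OF fin(1) _ x(2) c cocycle] x(2) unfolding B_def by blast
  ultimately have "Idl (x ` \<Lambda>) \<subseteq> B" by (rule R.genideal_minimal)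
  then have n: "\<exists>t\<in>S. t \<otimes> x p [^] n \<in> B" using t by auto
  have step: "\<exists>t\<in>S. t \<otimes> x p [^] m \<in> B" if tS: "t \<in> S" and tB: "t \<otimes> x p [^] Suc m \<in> B" for t m
  proof -
    have tR: "t \<in> carrier R" using tS S by auto
    define c0 where "c0 = (\<lambda>T. (t \<otimes> x p [^] m) \<odot>\<^bsub>M\<^esub> c T)"
    have c0: "c0 \<in> kcochains M \<Lambda> (Suc i)"
      unfolding c0_def using tR x c by (intro kcochains_smult) auto
    obtain c1 where c1: "c1 \<in> kcochains M \<Lambda> i"
      and d1: "kdiff M x \<Lambda> c1 = (\<lambda>T. (t \<otimes> x p [^] Suc m) \<odot>\<^bsub>M\<^esub> c T)"
      using tB unfolding B_def by auto
    note f0 = kcochains_kfun[OF c0] and f1 = kcochains_kfun[OF c1]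
    have "(t \<otimes> x p [^] Suc m) \<odot>\<^bsub>M\<^esub> c T = x p \<odot>\<^bsub>M\<^esub> c0 T" for T
      unfolding c0_def using tR x cc by (simp add: smult_assoc1[symmetric] R.m_ac)
    then have d1': "kdiff M x \<Lambda> c1 = (\<lambda>T. x p \<odot>\<^bsub>M\<^esub> c0 T)" using d1 by simp
    have d0: "kdiff M x \<Lambda> c0 = (\<lambda>_. \<zero>\<^bsub>M\<^esub>)"
      unfolding c0_def using tR x cc by (subst kdiff_smult) (auto simp: cocycle)
    have "kdiff M x (insert p \<Lambda>) (kpair M p c0 c1) = (\<lambda>_. \<zero>\<^bsub>M\<^esub>)"
      unfolding kdiff_kpair[OF fin f0 f1] d0 d1'
      using x kfunD(1)[OF f0] kpair_zero[of p] by (simp add: minus_self)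
    moreover have "kpair M p c0 c1 \<in> kcochains M (insert p \<Lambda>) (Suc i)"
      using fin c0 c1 by (intro kpair_kcochain)
    ultimately obtain s b where s: "s \<in> S" and b: "b \<in> kcochains M (insert p \<Lambda>) i"
      and sb: "kdiff M x (insert p \<Lambda>) b = (\<lambda>T. s \<odot>\<^bsub>M\<^esub> kpair M p c0 c1 T)"
      using ex unfolding kexact_def by blast
    have sR: "s \<in> carrier R" using s S by auto
    \<comment> \<open>For i = 0 the cochain b has degree -1, where \<open>kpair_ex\<close> does not
      apply and both components are zero. For b1 the cone formula asks only membership in
      \<open>kfun\<close>.\<close>
    obtain b0 b1 where b0: "b0 \<in> kcochains M \<Lambda> i" and b1: "b1 \<in> kfun M \<Lambda>" and bb: "b = kpair M p b0 b1"
    proof (cases i)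
      case 0
      then have "b = kpair M p (\<lambda>_. \<zero>\<^bsub>M\<^esub>) (\<lambda>_. \<zero>\<^bsub>M\<^esub>)"
        using b by (simp add: kcochains_0 kpair_zero)
      then show ?thesis using that zero_kcochain zero_kfun by blast
    next
      case (Suc j)
      obtain d0 d1 where "d0 \<in> kcochains M \<Lambda> (Suc j)" "d1 \<in> kcochains M \<Lambda> j" "b = kpair M p d0 d1"
        using kpair_ex[OF fin(1,2) b[unfolded Suc]] .
      then show ?thesis using that[of d0 d1] kcochains_kfun[of d1] Suc by simp
    qed
    note g0 = kcochains_kfun[OF b0]
    have "kpair M p (kdiff M x \<Lambda> b0) (\<lambda>S. x p \<odot>\<^bsub>M\<^esub> b0 S \<ominus>\<^bsub>M\<^esub> kdiff M x \<Lambda> b1 S)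
        = kpair M p (\<lambda>S. s \<odot>\<^bsub>M\<^esub> c0 S) (\<lambda>S. s \<odot>\<^bsub>M\<^esub> c1 S)"
      using sb kdiff_kpair[OF fin g0 b1] kpair_smult[OF f0 f1 sR, of p] unfolding bb by simp
    then have "kdiff M x \<Lambda> b0 = (\<lambda>S. s \<odot>\<^bsub>M\<^esub> c0 S)"
      by (rule kpair_eqD(1)[OF fin(2) kdiff_kfun[OF g0 x(2)]
            kfun_minus[OF kfun_smult[OF g0 x(1)] kdiff_kfun[OF b1 x(2)]]
            kfun_smult[OF f0 sR] kfun_smult[OF f1 sR]])
    also have "\<dots> = (\<lambda>S. (s \<otimes> t \<otimes> x p [^] m) \<odot>\<^bsub>M\<^esub> c S)"
      unfolding c0_def using sR tR x cc by (simp add: smult_assoc1[symmetric] R.m_assoc)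
    finally have "s \<otimes> t \<otimes> x p [^] m \<in> B"
      unfolding B_def using b0 sR tR x by blast
    then show ?thesis using S(2)[OF s tS] by blast
  qed
  have "\<exists>t\<in>S. t \<otimes> x p [^] (0::nat) \<in> B"
    using n by (induction n) (use step in blast)+
  then obtain s where "s \<in> S" "s \<in> B" using S(1) by auto
  then show "\<exists>t\<in>S. \<exists>b \<in> kcochains M \<Lambda> i. kdiff M x \<Lambda> b = (\<lambda>T. t \<odot>\<^bsub>M\<^esub> c T)"
    unfolding B_def by blast
qed

text \<open>Both lists are joined to \<open>xs @ ys\<close>: the members of ys are appended one by
  one, then those of xs are removed one by one, and a shift of indices leaves the complex of
  ys.\<close>

lemma kexact_list_radical:
  assumes xs: "set xs \<subseteq> carrier R" and ys: "set ys \<subseteq> carrier R"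
    and S: "S \<subseteq> carrier R" "\<And>s t. s \<in> S \<Longrightarrow> t \<in> S \<Longrightarrow> s \<otimes> t \<in> S"
    and rad: "\<And>x. x \<in> set xs \<Longrightarrow> \<exists>t\<in>S. \<exists>n::nat. t \<otimes> x [^] n \<in> Idl (set ys)"
    and ex: "\<And>j. j \<le> i \<Longrightarrow> kexact S M (nth xs) {..<length xs} j"
  shows "kexact S M (nth ys) {..<length ys} i"
proof -
  define z l m where "z = nth (xs @ ys)" and "l = length xs" and "m = length ys"
  have z: "z ` \<Lambda> \<subseteq> carrier R" if "\<Lambda> \<subseteq> {..<l + m}" for \<Lambda>
  proof -
    have "z ` {..<l + m} = set (xs @ ys)"
      using nth_image[of "l + m" "xs @ ys"] by (simp add: z_def l_def m_def lessThan_atLeast0)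
    then show ?thesis using that xs ys by auto
  qed
  have zl: "kexact S M z {..<l} j" if "j \<le> i" for j
  proof (rule kexact_reindex[where h = id and y = "nth xs"])
    show "kexact S M (nth xs) (id ` {..<l}) j" using ex[OF that] by (simp add: l_def)
    show "z ` {..<l} \<subseteq> carrier R" by (rule z) auto
  qed (auto simp: strict_mono_def z_def l_def nth_append)
  \<comment> \<open>All degrees up to i are carried along, since appending an element draws on the
    lower degrees too.\<close>
  have "kexact S M z {..<l + k} j" if "k \<le> m" "j \<le> i" for j k
    using that
  proof (induction k arbitrary: j)
    case 0
    then show ?case using zl by simp
  next
    case (Suc k)
    have "kexact S M z (insert (l + k) {..<l + k}) j"
    proof (rule kexact_insert)
      show "z ` insert (l + k) {..<l + k} \<subseteq> carrier R" by (rule z) (use Suc.prems in auto)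
    qed (use Suc S in auto)
    then show ?case by (simp add: lessThan_Suc)
  qed
  then have all: "kexact S M z {..<l + m} i" by simp
  \<comment> \<open>The members of xs leave from the front, so ys stays among the remaining elements
    and the radical condition remains available.\<close>
  have "kexact S M z {k..<l + m} i" if "k \<le> l" for k
    using that
  proof (induction k)
    case 0
    then show ?case using all by (simp add: lessThan_atLeast0)
  next
    case (Suc k)
    have eq: "insert k {Suc k..<l + m} = {k..<l + m}" using Suc.prems by auto
    have "z k \<in> set xs" using Suc.prems by (simp add: z_def l_def nth_append)
    then obtain t n where t: "t \<in> S" "t \<otimes> z k [^] (n::nat) \<in> Idl (set ys)" using rad by blast
    have "set ys \<subseteq> z ` {Suc k..<l + m}"
    proof
      fix y assume "y \<in> set ys"
      then obtain q where "q < m" "y = z (l + q)"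
        by (auto simp: in_set_conv_nth z_def l_def m_def)
      then show "y \<in> z ` {Suc k..<l + m}" using Suc.prems by auto
    qed
    then have "Idl (set ys) \<subseteq> Idl (z ` {Suc k..<l + m})"
      by (rule R.subset_Idl_subset[rotated]) (rule z, auto)
    then have "t \<otimes> z k [^] n \<in> Idl (z ` {Suc k..<l + m})" using t by blast
    with _ _ _ S t(1) show ?case
    proof (rule kexact_radical)
      show "z ` insert k {Suc k..<l + m} \<subseteq> carrier R" unfolding eq by (rule z) auto
      show "kexact S M z (insert k {Suc k..<l + m}) i" unfolding eq using Suc by simp
    qed auto
  qed
  then have "kexact S M z {l..<l + m} i" by simp
  moreover have "(+) l ` {..<m} = {l..<l + m}"
    by (simp add: lessThan_atLeast0 add.commute)
  ultimately have "kexact S M z ((+) l ` {..<m}) i" by simp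
  then show ?thesis
    unfolding m_def[symmetric]
    by (rule kexact_reindex[rotated 3]) (use ys in \<open>auto simp: strict_mono_def z_def l_def m_def\<close>)
qed

end

section \<open>Passage to the given definitions of cohomology and grade\<close>

lemma koszul_cochains_eq: "koszul_cochains M l i = kcochains M {..<l} (Suc i)"
  by (auto simp: koszul_cochains_def kcochains_def)

text \<open>On sets of the wrong size \<open>koszul_diff\<close> is zero by definition, and
  \<open>kdiff\<close> is zero because c vanishes at each T - {t}.\<close>

lemma koszul_diff_eq:
  assumes "Module.module R M" "set xs \<subseteq> carrier R" "c \<in> kcochains M {..<length xs} (Suc i)"
  shows "koszul_diff M xs i c = kdiff M (nth xs) {..<length xs} c"
proof
  interpret Module.module R M by fact
  fix T
  show "koszul_diff M xs i c T = kdiff M (nth xs) {..<length xs} c T"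
  proof (cases "T \<subseteq> {..<length xs} \<and> card T \<noteq> Suc i")
    case True
    then have fin: "finite T" using finite_subset by blast
    have "signed M (below T t) (xs ! t \<odot>\<^bsub>M\<^esub> c (T - {t})) = \<zero>\<^bsub>M\<^esub>" if "t \<in> T" for t
    proof -
      have "card (T - {t}) \<noteq> i"
        using card_Suc_Diff1[OF fin that] True by auto
      then have "c (T - {t}) = \<zero>\<^bsub>M\<^esub>" using assms(3) by (auto simp: kcochains_def)
      moreover have "xs ! t \<in> carrier R" using that True assms(2) nth_mem by blast
      ultimately show ?thesis by simp
    qed
    then have "(\<Oplus>\<^bsub>M\<^esub>t\<in>T. signed M (below T t) (xs ! t \<odot>\<^bsub>M\<^esub> c (T - {t}))) = \<zero>\<^bsub>M\<^esub>"
      by (rule M.add.finprod_one_eqI)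
    then show ?thesis using True by (simp add: koszul_diff_def kdiff_def)
  next
    case False
    then show ?thesis by (auto simp: koszul_diff_def kdiff_def signed_def below_def)
  qed
qed

text \<open>S = {1} stands for no localization. The separate clause for degree 0 is absorbed because
  the only cochain of degree -1 is zero.\<close>

lemma koszul_H_nonzero_iff:
  assumes "Module.module R M" "set xs \<subseteq> carrier R"
  shows "koszul_H_nonzero M xs i \<longleftrightarrow> \<not> kexact {\<one>\<^bsub>R\<^esub>} M (nth xs) {..<length xs} i"
proof -
  interpret Module.module R M by fact
  have x: "(!) xs ` {..<length xs} \<subseteq> carrier R" using assms(2) by auto
  have one: "(\<lambda>T. \<one>\<^bsub>R\<^esub> \<odot>\<^bsub>M\<^esub> c T) = c" if "c \<in> kcochains M {..<length xs} (Suc i)" for c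
    using kcochains_closed[OF that] by simp
  show ?thesis
  proof (cases i)
    case 0
    then show ?thesis
      using one kdiff_zero[OF x] koszul_diff_eq[OF assms, of _ i]
      by (auto simp: koszul_H_nonzero_def kexact_def koszul_cochains_eq kcochains_0)
  next
    case (Suc j)
    then show ?thesis
      using one koszul_diff_eq[OF assms, of _ i] koszul_diff_eq[OF assms, of _ j]
      by (auto simp: koszul_H_nonzero_def kexact_def koszul_cochains_eq)
  qed
qed

lemma Kgrade_list_le:
  assumes "\<And>i. koszul_H_nonzero N ys i \<Longrightarrow> \<exists>j\<le>i. koszul_H_nonzero M xs j"
  shows "Kgrade_list M xs \<le> Kgrade_list N ys"
  unfolding Kgrade_list_def
proof (rule INF_greatest)
  fix i assume "i \<in> {i. koszul_H_nonzero N ys i}"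
  then obtain j where "j \<le> i" "koszul_H_nonzero M xs j" using assms by blast
  then show "Inf (enat ` {i. koszul_H_nonzero M xs i}) \<le> enat i"
    by (intro INF_lower2[of j]) auto
qed

text \<open>With exponent 1 it says that lengthening a list cannot lower the grade; with higher
  powers it lets generators be traded within the same radical.\<close>

lemma Kgrade_list_radical:
  assumes M: "Module.module R M" and xs: "set xs \<subseteq> carrier R" and ys: "set ys \<subseteq> carrier R"
    and rad: "\<And>x. x \<in> set xs \<Longrightarrow> \<exists>n::nat. x [^]\<^bsub>R\<^esub> n \<in> Idl\<^bsub>R\<^esub> (set ys)"
  shows "Kgrade_list M xs \<le> Kgrade_list M ys"
proof (rule Kgrade_list_le)
  fix i assume i: "koszul_H_nonzero M ys i"
  interpret Module.module R M by fact
  show "\<exists>j\<le>i. koszul_H_nonzero M xs j"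
  proof (rule ccontr)
    assume "\<not> ?thesis"
    then have ex: "\<And>j. j \<le> i \<Longrightarrow> kexact {\<one>\<^bsub>R\<^esub>} M (nth xs) {..<length xs} j"
      using koszul_H_nonzero_iff[OF M xs] by blast
    have rad': "\<exists>t\<in>{\<one>\<^bsub>R\<^esub>}. \<exists>n::nat. t \<otimes>\<^bsub>R\<^esub> x [^]\<^bsub>R\<^esub> n \<in> Idl\<^bsub>R\<^esub> (set ys)" if x: "x \<in> set xs" for x
    proof -
      obtain n :: nat where n: "x [^]\<^bsub>R\<^esub> n \<in> Idl\<^bsub>R\<^esub> (set ys)" using rad[OF x] by blast
      have "x \<in> carrier R" using xs x by auto
      then have "\<one>\<^bsub>R\<^esub> \<otimes>\<^bsub>R\<^esub> x [^]\<^bsub>R\<^esub> n = x [^]\<^bsub>R\<^esub> n" by simp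
      with n have "\<one>\<^bsub>R\<^esub> \<otimes>\<^bsub>R\<^esub> x [^]\<^bsub>R\<^esub> n \<in> Idl\<^bsub>R\<^esub> (set ys)" by simp
      then show ?thesis by blast
    qed
    have "kexact {\<one>\<^bsub>R\<^esub>} M (nth ys) {..<length ys} i"
      by (rule kexact_list_radical[OF xs ys _ _ rad' ex]) auto
    then show False using i koszul_H_nonzero_iff[OF M ys] by blast
  qed
qed

section \<open>Koszul grade is bounded by height\<close>

lemma (in ideal) add_mem_cancel:
  assumes "u \<in> carrier R" "v \<in> I" "u \<oplus> v \<in> I"
  shows "u \<in> I"
proof -
  have "(u \<oplus> v) \<oplus> \<ominus> v \<in> I" using assms by (blast intro: a_closed a_inv_closed)
  moreover have "(u \<oplus> v) \<oplus> \<ominus> v = u" using assms by (simp add: a_assoc r_neg)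
  ultimately show ?thesis by simp
qed

context cring begin

lemma subset_ideal_sum:
  assumes "ideal K R" "ideal L R"
  shows "K \<subseteq> K <+>\<^bsub>R\<^esub> L" "L \<subseteq> K <+>\<^bsub>R\<^esub> L"
proof -
  interpret K: ideal K R by fact
  interpret L: ideal L R by fact
  show "K \<subseteq> K <+>\<^bsub>R\<^esub> L"
  proof
    fix a assume a: "a \<in> K"
    have "a \<oplus> \<zero> \<in> K <+>\<^bsub>R\<^esub> L"
      unfolding set_add_def' by (rule UN_I[OF a], rule UN_I[OF L.zero_closed]) simp
    then show "a \<in> K <+>\<^bsub>R\<^esub> L" using a by simp
  qed
  show "L \<subseteq> K <+>\<^bsub>R\<^esub> L"
  proof
    fix a assume a: "a \<in> L"
    have "\<zero> \<oplus> a \<in> K <+>\<^bsub>R\<^esub> L"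
      unfolding set_add_def' by (rule UN_I[OF K.zero_closed], rule UN_I[OF a]) simp
    then show "a \<in> K <+>\<^bsub>R\<^esub> L" using a by simp
  qed
qed

text \<open>Krull's argument: by Zorn's lemma there is a maximal ideal among those containing I and
  missing D, and maximality makes it prime.\<close>

lemma exists_prime_disjoint:
  assumes I: "ideal I R" and D: "D \<subseteq> carrier R" "\<one> \<in> D" "\<And>a b. a \<in> D \<Longrightarrow> b \<in> D \<Longrightarrow> a \<otimes> b \<in> D"
    and disj: "I \<inter> D = {}"
  shows "\<exists>Q. primeideal Q R \<and> I \<subseteq> Q \<and> Q \<inter> D = {}"
proof -
  let ?A = "{K. ideal K R \<and> I \<subseteq> K \<and> K \<inter> D = {}}"
  have "\<exists>Q\<in>?A. \<forall>X\<in>?A. Q \<subseteq> X \<longrightarrow> X = Q"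
  proof (rule subset_Zorn_nonempty)
    show "?A \<noteq> {}" using I disj by blast
    fix C assume ne: "C \<noteq> {}" and ch: "subset.chain ?A C"
    have id: "ideal K R" "I \<subseteq> K" "K \<inter> D = {}" if "K \<in> C" for K
      using ch that by (auto simp: subset.chain_def)
    have "ideal (\<Union>C) R"
    proof (rule ideal_if_closed)
      show "\<Union>C \<subseteq> carrier R"
        using id(1) by (auto dest: ideal.Icarr)
      show "\<zero> \<in> \<Union>C"
        using ne id(1) by (meson UnionI additive_subgroup.zero_closed ex_in_conv ideal.axioms(1))
      show "a \<oplus> b \<in> \<Union>C" if ab: "a \<in> \<Union>C" "b \<in> \<Union>C" for a b
      proof -
        obtain K L where K: "K \<in> C" "a \<in> K" and L: "L \<in> C" "b \<in> L" using ab by auto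
        have "K \<subseteq> L \<or> L \<subseteq> K" using ch K L by (auto simp: subset_chain_def)
        then obtain H where "H \<in> C" "a \<in> H" "b \<in> H" using K L by blast
        then show ?thesis
          using id(1)[of H] by (meson UnionI additive_subgroup.a_closed ideal.axioms(1))
      qed
      show "r \<otimes> a \<in> \<Union>C" if "a \<in> \<Union>C" "r \<in> carrier R" for a r
        using that id(1) by (meson Union_iff ideal.I_l_closed)
    qed
    then show "\<Union>C \<in> ?A" using id ne by blast
  qed
  then obtain Q where Q: "ideal Q R" "I \<subseteq> Q" "Q \<inter> D = {}"
    and max: "\<And>X. ideal X R \<Longrightarrow> I \<subseteq> X \<Longrightarrow> X \<inter> D = {} \<Longrightarrow> Q \<subseteq> X \<Longrightarrow> X = Q"
    by auto
  interpret Q: ideal Q R by fact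
  have meets: "\<exists>m\<in>Q. \<exists>r\<in>carrier R. m \<oplus> r \<otimes> a \<in> D" if a: "a \<in> carrier R" "a \<notin> Q" for a
  proof -
    let ?K = "Q <+>\<^bsub>R\<^esub> PIdl a"
    have K: "ideal ?K R" using Q(1) cgenideal_ideal[OF a(1)] by (rule add_ideals)
    have "Q \<subseteq> ?K" "a \<in> ?K"
      using subset_ideal_sum[OF Q(1) cgenideal_ideal[OF a(1)]] cgenideal_self[OF a(1)] by auto
    then have "?K \<inter> D \<noteq> {}" using max[OF K] Q(2) a(2) by blast
    then show ?thesis by (auto simp: set_add_defs cgenideal_def)
  qed
  have "primeideal Q R"
  proof (rule primeidealI[OF Q(1) cring_axioms])
    show "carrier R \<noteq> Q" using D(2) Q(3) by auto
    fix a b assume ab: "a \<in> carrier R" "b \<in> carrier R" "a \<otimes> b \<in> Q"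
    show "a \<in> Q \<or> b \<in> Q"
    proof (rule ccontr)
      assume "\<not> (a \<in> Q \<or> b \<in> Q)"
      then obtain m r n s where m: "m \<in> Q" "r \<in> carrier R" "m \<oplus> r \<otimes> a \<in> D"
        and n: "n \<in> Q" "s \<in> carrier R" "n \<oplus> s \<otimes> b \<in> D"
        using meets ab by metis
      have mc: "m \<in> carrier R" "n \<in> carrier R" using m n by auto
      \<comment> \<open>The product of two members of D, expanded: each term contains m, n or a b
        and so lies in Q, against disjointness.\<close>
      have "(m \<oplus> r \<otimes> a) \<otimes> (n \<oplus> s \<otimes> b) = (n \<oplus> s \<otimes> b) \<otimes> m \<oplus> (r \<otimes> a \<otimes> n \<oplus> (r \<otimes> s) \<otimes> (a \<otimes> b))"
        using m n ab mc by (simp add: l_distr r_distr m_ac a_ac)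
      also have "\<dots> \<in> Q"
      proof (intro Q.a_closed)
        show "(n \<oplus> s \<otimes> b) \<otimes> m \<in> Q" by (rule Q.I_l_closed) (use m n ab mc in auto)
        show "r \<otimes> a \<otimes> n \<in> Q" by (rule Q.I_l_closed) (use m n ab mc in auto)
        show "r \<otimes> s \<otimes> (a \<otimes> b) \<in> Q" by (rule Q.I_l_closed) (use m n ab mc in auto)
      qed
      finally show False using D(3)[OF m(3) n(3)] Q(3) by auto
    qed
  qed
  then show ?thesis using Q by blast
qed

text \<open>The last assumption says that x is outside the radical of I localized at p. The prime is
  chosen disjoint from all t x^n with t outside p: exponent 0 forces it inside p, and t = 1 forces
  it to omit x.\<close>

lemma exists_prime_below:
  assumes p: "primeideal p R" and I: "ideal I R" and x: "x \<in> carrier R"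
    and av: "\<And>t n. t \<in> carrier R - p \<Longrightarrow> t \<otimes> x [^] (n::nat) \<notin> I"
  shows "\<exists>Q. primeideal Q R \<and> I \<subseteq> Q \<and> Q \<subseteq> p \<and> x \<notin> Q"
proof -
  interpret p: primeideal p R by fact
  let ?D = "{t \<otimes> x [^] (n::nat) |t n. t \<in> carrier R - p}"
  have one: "\<one> \<in> carrier R - p" using p.I_notcarr p.one_imp_carrier by auto
  have "\<exists>Q. primeideal Q R \<and> I \<subseteq> Q \<and> Q \<inter> ?D = {}"
  proof (rule exists_prime_disjoint[OF I])
    show "?D \<subseteq> carrier R" using x by auto
    have "\<one> = \<one> \<otimes> x [^] (0::nat)" by simp
    then show "\<one> \<in> ?D" using one by blast
    show "I \<inter> ?D = {}" using av by auto
    fix a b assume "a \<in> ?D" "b \<in> ?D"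
    then obtain t n s m where ab: "a = t \<otimes> x [^] (n::nat)" "t \<in> carrier R - p"
      "b = s \<otimes> x [^] (m::nat)" "s \<in> carrier R - p" by auto
    then have "t \<otimes> s \<in> carrier R - p" using p.I_prime by auto
    moreover have "a \<otimes> b = (t \<otimes> s) \<otimes> x [^] (n + m)"
      using ab x by (simp add: nat_pow_mult[symmetric] m_ac)
    ultimately show "a \<otimes> b \<in> ?D" by blast
  qed
  then obtain Q where Q: "primeideal Q R" "I \<subseteq> Q" "Q \<inter> ?D = {}" by blast
  interpret Q: primeideal Q R by fact
  have "x \<notin> Q"
  proof
    assume "x \<in> Q"
    moreover have "x = \<one> \<otimes> x [^] (1::nat)" using x by simp
    then have "x \<in> ?D" using one by blast
    ultimately show False using Q(3) by blast
  qed
  moreover have "Q \<subseteq> p"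
  proof
    fix a assume a: "a \<in> Q"
    show "a \<in> p"
    proof (rule ccontr)
      assume "a \<notin> p"
      then have "a \<otimes> x [^] (0::nat) \<in> ?D" using Q.Icarr[OF a] by blast
      then show False using a Q(3) by auto
    qed
  qed
  ultimately show ?thesis using Q by blast
qed

text \<open>Such a chain is a chain of length n in the spectrum of R/I localized at p with x
  inverted; its absence says that this ring has dimension below n.\<close>

definition chain_avoiding :: "'a set \<Rightarrow> 'a \<Rightarrow> 'a set \<Rightarrow> nat \<Rightarrow> bool" where
  "chain_avoiding I x p n \<longleftrightarrow> (\<exists>C. (\<forall>k\<le>n. primeideal (C k) R) \<and> (\<forall>k<n. C k \<subset> C (Suc k)) \<and>
     I \<subseteq> C 0 \<and> C n \<subseteq> p \<and> x \<notin> C n)"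

text \<open>Induction through the Krull boundary \<open>I' = (\<surd>I : y) + (y)\<close>, with the radical taken over the
  primes below \<open>p\<close>: no prime containing \<open>I'\<close> is minimal over \<open>I\<close>, so passing from \<open>I\<close> to \<open>I'\<close>
  shortens the chains.\<close>

lemma kronecker_avoiding:
  assumes p: "primeideal p R" and x: "x \<in> carrier R"
    and "set ys \<subseteq> carrier R" "ideal I R" "\<not> chain_avoiding I x p (length ys)"
  shows "\<exists>as. length as = length ys \<and> set as \<subseteq> carrier R \<and>
    (\<forall>Q. primeideal Q R \<longrightarrow> Q \<subseteq> p \<longrightarrow> I \<subseteq> Q \<longrightarrow> (\<forall>(y, a)\<in>set (zip ys as). y \<oplus> x \<otimes> a \<in> Q) \<longrightarrow> x \<in> Q)"
  using assms(3-)
proof (induction ys arbitrary: I)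
  case Nil
  \<comment> \<open>A chain of length 0 is a single prime, so its absence already says that x lies
    in every prime in question.\<close>
  have "x \<in> Q" if "primeideal Q R" "Q \<subseteq> p" "I \<subseteq> Q" for Q
    using Nil that unfolding chain_avoiding_def by (auto dest!: spec[of _ "\<lambda>_. Q"])
  then show ?case by simp
next
  case (Cons y ys)
  interpret I: ideal I R by fact
  have y: "y \<in> carrier R" using Cons.prems by simp
  define N where "N = {s \<in> carrier R. \<forall>Q. primeideal Q R \<longrightarrow> Q \<subseteq> p \<longrightarrow> I \<subseteq> Q \<longrightarrow> s \<otimes> y \<in> Q}"
  have N: "ideal N R"
  proof (rule ideal_if_closed)
    show "N \<subseteq> carrier R" by (auto simp: N_def)
    show "\<zero> \<in> N" using y by (auto simp: N_def primeideal_def ideal_def additive_subgroup.zero_closed)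
    show "a \<oplus> b \<in> N" if "a \<in> N" "b \<in> N" for a b
      using that y
      by (auto simp: N_def l_distr primeideal_def ideal_def intro!: additive_subgroup.a_closed)
    show "r \<otimes> a \<in> N" if "a \<in> N" "r \<in> carrier R" for a r
    proof -
      have "a \<otimes> y \<in> Q \<Longrightarrow> r \<otimes> a \<otimes> y \<in> Q" if "primeideal Q R" for Q
        using that \<open>a \<in> N\<close> \<open>r \<in> carrier R\<close> y
        by (simp add: N_def m_assoc ideal.I_l_closed primeideal_def)
      then show ?thesis using that by (auto simp: N_def)
    qed
  qed
  have IN: "I \<subseteq> N"
    using y by (auto simp: N_def primeideal_def intro!: ideal.I_r_closed)
  define I' where "I' = N <+>\<^bsub>R\<^esub> PIdl y"
  have I': "ideal I' R" unfolding I'_def using N cgenideal_ideal[OF y] by (rule add_ideals)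
  have sub: "I' \<subseteq> Q \<longleftrightarrow> N \<subseteq> Q \<and> y \<in> Q" if "ideal Q R" for Q
  proof -
    interpret Q: ideal Q R by fact
    have "N \<subseteq> I'" "y \<in> I'"
      unfolding I'_def
      using subset_ideal_sum[OF N cgenideal_ideal[OF y]] cgenideal_self[OF y] by auto
    moreover have "I' \<subseteq> Q" if "N \<subseteq> Q" "y \<in> Q"
      using that by (auto simp: I'_def set_add_defs cgenideal_def intro!: Q.a_closed Q.I_l_closed)
    ultimately show ?thesis by blast
  qed
  have "\<not> chain_avoiding I' x p (length ys)"
  proof
    assume "chain_avoiding I' x p (length ys)"
    then obtain C where C: "\<And>k. k \<le> length ys \<Longrightarrow> primeideal (C k) R"
      "\<And>k. k < length ys \<Longrightarrow> C k \<subset> C (Suc k)" "I' \<subseteq> C 0" "C (length ys) \<subseteq> p" "x \<notin> C (length ys)"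
      unfolding chain_avoiding_def by auto
    interpret C0: primeideal "C 0" R using C(1) by simp
    have yC: "y \<in> C 0" "N \<subseteq> C 0" using C(3) sub[OF C0.is_ideal] by auto
    \<comment> \<open>Were C 0 minimal over I, some t outside C 0 would have t y^n in I; then t y
      lies in every prime over I, so t belongs to N and hence to C 0.\<close>
    have "\<exists>Q. primeideal Q R \<and> I \<subseteq> Q \<and> Q \<subseteq> C 0 \<and> y \<notin> Q"
    proof (rule exists_prime_below[OF C(1) Cons.prems(2) y], simp)
      fix t n assume t: "t \<in> carrier R - C 0"
      show "t \<otimes> y [^] (n::nat) \<notin> I"
      proof
        assume I: "t \<otimes> y [^] n \<in> I"
        have "t \<otimes> y \<in> Q" if Q: "primeideal Q R" "I \<subseteq> Q" for Q
        proof -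
          interpret Q: primeideal Q R by fact
          have "t \<otimes> y [^] m \<in> Q \<Longrightarrow> t \<otimes> y \<in> Q" for m :: nat
          proof (induction m)
            case 0
            then show ?case using t y by (auto intro: Q.I_r_closed)
          next
            case (Suc m)
            then show ?case
              using t y Q.I_prime[of "t \<otimes> y [^] m" y] by (auto simp: m_assoc intro: Q.I_l_closed)
          qed
          then show ?thesis using I Q by blast
        qed
        then have "t \<in> N" using t by (auto simp: N_def)
        then show False using t yC by auto
      qed
    qed
    then obtain Q where Q: "primeideal Q R" "I \<subseteq> Q" "Q \<subseteq> C 0" "y \<notin> Q" by blast
    \<comment> \<open>The chain grows by one at the bottom: Q is strictly below C 0 because it omits
      y.\<close>
    define C' where "C' = (\<lambda>k. case k of 0 \<Rightarrow> Q | Suc j \<Rightarrow> C j)"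
    have "chain_avoiding I x p (length (y # ys))"
      unfolding chain_avoiding_def
    proof (intro exI[of _ C'] conjI allI impI)
      fix k assume "k < length (y # ys)"
      then show "C' k \<subset> C' (Suc k)"
        using Q yC C(2) by (auto simp: C'_def split: nat.split)
    qed (use Q C in \<open>auto simp: C'_def split: nat.split\<close>)
    then show False using Cons.prems by blast
  qed
  then obtain as where as: "length as = length ys" "set as \<subseteq> carrier R"
    and asQ: "\<And>Q. primeideal Q R \<Longrightarrow> Q \<subseteq> p \<Longrightarrow> I' \<subseteq> Q \<Longrightarrow> (\<forall>(y, a)\<in>set (zip ys as). y \<oplus> x \<otimes> a \<in> Q) \<Longrightarrow> x \<in> Q"
    using Cons.IH[OF _ I'] Cons.prems by auto
  define Z where "Z = insert y ((\<lambda>(y, a). y \<oplus> x \<otimes> a) ` set (zip ys as))"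
  have Zc: "Z \<subseteq> carrier R"
  proof -
    have "b \<oplus> x \<otimes> a \<in> carrier R" if "(b, a) \<in> set (zip ys as)" for a b
      using set_zip_leftD[OF that] set_zip_rightD[OF that] x as(2) Cons.prems(1) by auto
    then show ?thesis using y by (auto simp: Z_def)
  qed
  define K where "K = N <+>\<^bsub>R\<^esub> Idl Z"
  have K: "ideal K R" unfolding K_def using N genideal_ideal[OF Zc] by (rule add_ideals)
  have NK: "N \<subseteq> K" "Z \<subseteq> K"
    using subset_ideal_sum[OF N genideal_ideal[OF Zc]] genideal_self[OF Zc] by (auto simp: K_def)
  \<comment> \<open>By the induction hypothesis every prime below p that contains N and Z contains
    x. Hence t x^n lies in N + (Z) for some t outside p, and its component s in N becomes the
    coefficient for y.\<close>
  have "\<exists>t n. t \<in> carrier R - p \<and> t \<otimes> x [^] (n::nat) \<in> K"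
  proof (rule ccontr)
    assume "\<not> ?thesis"
    then obtain Q where Q: "primeideal Q R" "K \<subseteq> Q" "Q \<subseteq> p" "x \<notin> Q"
      using exists_prime_below[OF p K x] by blast
    interpret Q: primeideal Q R by fact
    have "I' \<subseteq> Q" using NK Q sub[OF Q.is_ideal] by (auto simp: Z_def)
    moreover have "\<forall>(y, a)\<in>set (zip ys as). y \<oplus> x \<otimes> a \<in> Q"
    proof clarify
      fix b a assume "(b, a) \<in> set (zip ys as)"
      then have "b \<oplus> x \<otimes> a \<in> Z" by (force simp: Z_def)
      then show "b \<oplus> x \<otimes> a \<in> Q" using NK Q by blast
    qed
    ultimately show False using asQ[OF Q(1,3)] Q(4) by blast
  qed
  then obtain t n s w where t: "t \<in> carrier R - p" and s: "s \<in> N" and w: "w \<in> Idl Z"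
    and sw: "t \<otimes> x [^] (n::nat) = s \<oplus> w"
    unfolding K_def by (auto simp: set_add_defs)
  have sc: "s \<in> carrier R" using s by (simp add: N_def)
  have "x \<in> Q" if Q: "primeideal Q R" "Q \<subseteq> p" "I \<subseteq> Q"
    and yQ: "y \<oplus> x \<otimes> s \<in> Q" and ysQ: "\<forall>(y, a)\<in>set (zip ys as). y \<oplus> x \<otimes> a \<in> Q" for Q
  proof (rule ccontr)
    assume xQ: "x \<notin> Q"
    interpret Q: primeideal Q R by fact
    \<comment> \<open>The choice of s pays off: since x is not in Q, having s y and y + x s in Q
      forces both s and y into Q. Then Q contains s + w = t x^n, although neither t nor x is in
      Q.\<close>
    have "s \<otimes> y \<in> Q" using s Q by (auto simp: N_def)
    then have "s \<in> Q \<or> y \<in> Q" using Q.I_prime sc y by blast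
    then have "s \<in> Q \<and> y \<in> Q"
    proof
      assume sQ: "s \<in> Q"
      show ?thesis using Q.add_mem_cancel[OF y Q.I_l_closed[OF sQ x] yQ] sQ by simp
    next
      assume y': "y \<in> Q"
      have "x \<otimes> s \<in> Q"
        using Q.add_mem_cancel[OF _ y', of "x \<otimes> s"] x y sc yQ by (simp add: a_comm)
      then show ?thesis using y' xQ Q.I_prime[OF x sc] by simp
    qed
    then have "s \<in> Q" "Z \<subseteq> Q" using ysQ by (auto simp: Z_def)
    then have "w \<in> Q" using w genideal_minimal[OF Q.is_ideal] by blast
    then have "t \<otimes> x [^] n \<in> Q" using sw \<open>s \<in> Q\<close> by simp
    moreover have "t \<otimes> x [^] m \<in> Q \<Longrightarrow> t \<in> Q" for m :: nat
    proof (induction m)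
      case (Suc m)
      then show ?case using t x xQ Q.I_prime[of "t \<otimes> x [^] m" x] by (auto simp: m_assoc)
    qed (use t in auto)
    ultimately show False using t Q(2) by blast
  qed
  then show ?case
    using as sc by (intro exI[of _ "s # as"]) auto
qed

text \<open>The elements of xs are absorbed one at a time while the number n stays fixed:
  Kronecker's theorem at I = 0 replaces each y by some y + x a. A prime below p containing these
  contains x, hence the old ys, hence the rest of xs.\<close>

lemma radical_generation_bound:
  assumes p: "primeideal p R" and "set xs \<subseteq> p"
    and dim: "\<nexists>C. (\<forall>k\<le>Suc n. primeideal (C k) R) \<and> (\<forall>k<Suc n. C k \<subset> C (Suc k)) \<and> C (Suc n) = p"
  shows "\<exists>zs. length zs = n \<and> set zs \<subseteq> p \<and>
    (\<forall>Q. primeideal Q R \<longrightarrow> Q \<subseteq> p \<longrightarrow> set zs \<subseteq> Q \<longrightarrow> set xs \<subseteq> Q)"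
  using assms(2)
proof (induction xs)
  case Nil
  interpret p: primeideal p R by fact
  \<comment> \<open>Nothing has to be absorbed yet; the zeros only provide the length n, which has
    to match the bound on chains later.\<close>
  show ?case by (intro exI[of _ "replicate n \<zero>"]) (auto simp: set_replicate_conv_if)
next
  case (Cons x xs)
  interpret p: primeideal p R by fact
  obtain ys where ys: "length ys = n" "set ys \<subseteq> p"
    and ysQ: "\<And>Q. primeideal Q R \<Longrightarrow> Q \<subseteq> p \<Longrightarrow> set ys \<subseteq> Q \<Longrightarrow> set xs \<subseteq> Q"
    using Cons by auto
  have x: "x \<in> p" "x \<in> carrier R" using Cons.prems by auto
  have ysc: "set ys \<subseteq> carrier R" using ys by auto
  \<comment> \<open>A chain of length n whose top omits x would extend by p, which contains x, to
    length n + 1.\<close>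
  have "\<not> chain_avoiding {\<zero>} x p n"
  proof
    assume "chain_avoiding {\<zero>} x p n"
    then obtain C where C: "\<And>k. k \<le> n \<Longrightarrow> primeideal (C k) R"
      "\<And>k. k < n \<Longrightarrow> C k \<subset> C (Suc k)" "C n \<subseteq> p" "x \<notin> C n"
      unfolding chain_avoiding_def by auto
    define C' where "C' = (\<lambda>k. if k \<le> n then C k else p)"
    have "C' k \<subset> C' (Suc k)" if "k < Suc n" for k
      using that C x(1) by (cases "k = n") (auto simp: C'_def)
    then have "(\<forall>k\<le>Suc n. primeideal (C' k) R) \<and> (\<forall>k<Suc n. C' k \<subset> C' (Suc k)) \<and> C' (Suc n) = p"
      using C(1) p by (auto simp: C'_def)
    then show False using dim by blast
  qed
  then obtain as where as: "length as = length ys" "set as \<subseteq> carrier R"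
    and asQ: "\<And>Q. primeideal Q R \<Longrightarrow> Q \<subseteq> p \<Longrightarrow> {\<zero>} \<subseteq> Q \<Longrightarrow>
      (\<forall>(y, a)\<in>set (zip ys as). y \<oplus> x \<otimes> a \<in> Q) \<Longrightarrow> x \<in> Q"
    using kronecker_avoiding[OF p x(2) ysc zeroideal] ys(1) by auto
  define zs where "zs = map (\<lambda>(y, a). y \<oplus> x \<otimes> a) (zip ys as)"
  have carr: "y \<in> p" "a \<in> carrier R" if "(y, a) \<in> set (zip ys as)" for y a
    using set_zip_leftD[OF that] set_zip_rightD[OF that] as ys by auto
  have "set (x # xs) \<subseteq> Q" if Q: "primeideal Q R" "Q \<subseteq> p" "set zs \<subseteq> Q" for Q
  proof -
    interpret Q: primeideal Q R by fact
    have xQ: "x \<in> Q" using Q by (intro asQ) (auto simp: zs_def)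
    have "set ys \<subseteq> Q"
    proof
      fix y assume "y \<in> set ys"
      then obtain a where ya: "(y, a) \<in> set (zip ys as)"
        using as(1) by (metis in_set_impl_in_set_zip1)
      note c = carr[OF ya]
      then have yc: "y \<in> carrier R" by auto
      have "y \<oplus> x \<otimes> a \<in> set zs" using ya by (force simp: zs_def)
      then show "y \<in> Q"
        using Q(3) Q.add_mem_cancel[OF yc Q.I_r_closed[OF xQ c(2)]] by blast
    qed
    then show ?thesis using ysQ[OF Q(1,2)] xQ by simp
  qed
  moreover have "set zs \<subseteq> p"
    using carr x by (auto simp: zs_def intro!: p.a_closed p.I_r_closed)
  moreover have "length zs = n" using as ys by (simp add: zs_def)
  ultimately show ?case by blast
qed

end

section \<open>Top Koszul cohomology and the bound by height\<close>

lemma self_module_simps [simp]: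
  "carrier (self_module R) = carrier R" "zero (self_module R) = \<zero>\<^bsub>R\<^esub>"
  "add (self_module R) = add R" "smult (self_module R) = mult R"
  "a_inv (self_module R) = a_inv R" "finsum (self_module R) = finsum R"
  by (simp_all add: self_module_def a_inv_def finsum_def fun_eq_iff m_inv_def finprod_def)

lemma self_module_is_module:
  assumes "cring R" shows "Module.module R (self_module R)"
proof -
  interpret cring R by fact
  show ?thesis
    by (rule moduleI[OF cring_axioms])
      (auto simp: l_distr r_distr m_assoc intro!: abelian_groupI a_assoc a_comm intro: add.l_inv_ex)
qed

lemma (in ideal) finsum_in_ideal: "g \<in> A \<rightarrow> I \<Longrightarrow> finsum R g A \<in> I"
proof (induction A rule: infinite_finite_induct)
  case (insert a A)
  then have "g \<in> A \<rightarrow> carrier R" "g a \<in> carrier R" using Icarr by (auto simp: Pi_def)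
  then show ?case using insert by simp
qed simp_all

text \<open>The top Koszul cohomology is \<open>R/(zs)\<close>, which survives localization at \<open>p\<close>.\<close>

lemma top_koszul_not_exact:
  assumes "primeideal p R" "set zs \<subseteq> p"
  shows "\<not> kexact (carrier R - p) (self_module R) (nth zs) {..<length zs} (length zs)"
proof
  interpret p: primeideal p R by fact
  interpret M: Module.module R "self_module R" by (rule self_module_is_module[OF p.is_cring])
  let ?\<Lambda> = "{..<length zs}"
  assume ex: "kexact (carrier R - p) (self_module R) (nth zs) ?\<Lambda> (length zs)"
  \<comment> \<open>The value 1 on the top basis element represents the generator of R/(zs).\<close>
  define c where "c = (\<lambda>T. if T = ?\<Lambda> then \<one>\<^bsub>R\<^esub> else \<zero>\<^bsub>R\<^esub>)"
  have z: "zs ! t \<in> p" "zs ! t \<in> carrier R" if "t < length zs" for t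
    using that assms(2) by (auto simp: p.Icarr subset_iff)
  have "c \<in> kcochains (self_module R) ?\<Lambda> (Suc (length zs))"
    by (auto simp: c_def kcochains_def dest: card_subset_eq[OF finite_lessThan, rotated])
  moreover have "kdiff (self_module R) (nth zs) ?\<Lambda> c T = \<zero>\<^bsub>R\<^esub>" for T
  proof (cases "T \<subseteq> ?\<Lambda>")
    case True
    have "signed (self_module R) (below T t) (zs ! t \<otimes>\<^bsub>R\<^esub> c (T - {t})) = \<zero>\<^bsub>R\<^esub>" if "t \<in> T" for t
    proof -
      have "T - {t} \<noteq> ?\<Lambda>" "t < length zs" using True that by auto
      then show ?thesis using z[of t] M.signed_zero by (simp add: c_def)
    qed
    then show ?thesis using True by (simp add: kdiff_def p.add.finprod_one_eqI)
  qed (simp add: kdiff_def)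
  then have "kdiff (self_module R) (nth zs) ?\<Lambda> c = (\<lambda>_. \<zero>\<^bsub>self_module R\<^esub>)" by auto
  ultimately obtain t b where t: "t \<in> carrier R - p" and b: "b \<in> kcochains (self_module R) ?\<Lambda> (length zs)"
    and tb: "kdiff (self_module R) (nth zs) ?\<Lambda> b = (\<lambda>T. t \<otimes>\<^bsub>R\<^esub> c T)"
    using ex unfolding kexact_def by auto
  \<comment> \<open>The top value of a coboundary is a combination of members of zs and so lies in
    p, whereas t times the generator has top value t outside p.\<close>
  have "kdiff (self_module R) (nth zs) ?\<Lambda> b ?\<Lambda> \<in> p"
  proof -
    have "signed (self_module R) m (zs ! t \<otimes>\<^bsub>R\<^esub> b T) \<in> p" if "t < length zs" for t T m
    proof -
      have "b T \<in> carrier R" using M.kcochains_closed[OF b] by simp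
      then have "zs ! t \<otimes>\<^bsub>R\<^esub> b T \<in> p" using z[OF that] by (intro p.I_r_closed)
      then show ?thesis by (simp add: signed_def)
    qed
    then show ?thesis by (auto simp: kdiff_def intro!: p.finsum_in_ideal)
  qed
  then have "t \<otimes>\<^bsub>R\<^esub> \<one>\<^bsub>R\<^esub> \<in> p" using tb by (simp add: c_def)
  then show False using t by simp
qed

lemma kexact_mono:
  assumes "kexact S' M x \<Lambda> i" "S' \<subseteq> S"
  shows "kexact S M x \<Lambda> i"
  using assms unfolding kexact_def by blast

text \<open>In dimension n there are n elements zs of p such that, at p, xs lies in their radical.
  Vanishing for xs through degree n would pass to zs, whose cohomology in degree n is nonzero at p.
  In infinite dimension there is nothing to show.\<close>

lemma Kgrade_list_le_local_dim:
  fixes R :: "'a ring"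
  assumes p: "primeideal p R" and xs: "set xs \<subseteq> p"
  shows "Kgrade_list (self_module R) xs \<le> local_dim R p"
proof (cases "local_dim R p")
  case (enat n)
  interpret p: primeideal p R by fact
  interpret M: Module.module R "self_module R" by (rule self_module_is_module[OF p.is_cring])
  have "\<nexists>C. (\<forall>k\<le>Suc n. primeideal (C k) R) \<and> (\<forall>k<Suc n. C k \<subset> C (Suc k)) \<and> C (Suc n) = p"
  proof
    assume "\<exists>C. (\<forall>k\<le>Suc n. primeideal (C k) R) \<and> (\<forall>k<Suc n. C k \<subset> C (Suc k)) \<and> C (Suc n) = p"
    then have "enat (Suc n) \<le> local_dim R p"
      unfolding local_dim_def by (intro Sup_upper) blast
    then show False using enat by simp
  qed
  from p.radical_generation_bound[OF p xs this]
  obtain zs where zs: "length zs = n" "set zs \<subseteq> p"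
    and zsQ: "\<And>Q. primeideal Q R \<Longrightarrow> Q \<subseteq> p \<Longrightarrow> set zs \<subseteq> Q \<Longrightarrow> set xs \<subseteq> Q" by blast
  have carr: "set xs \<subseteq> carrier R" "set zs \<subseteq> carrier R" using xs zs by auto
  have one: "\<one>\<^bsub>R\<^esub> \<in> carrier R - p" using p.I_notcarr p.one_imp_carrier by auto
  have "\<exists>j\<le>n. koszul_H_nonzero (self_module R) xs j"
  proof (rule ccontr)
    assume "\<not> ?thesis"
    then have ex: "kexact (carrier R - p) (self_module R) (nth xs) {..<length xs} j" if "j \<le> n" for j
      using koszul_H_nonzero_iff[OF M.module_axioms carr(1)] that one
      by (blast intro: kexact_mono)
    \<comment> \<open>Otherwise a prime below p would contain zs and omit x, against the choice of
      zs.\<close>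
    have rad: "\<exists>t\<in>carrier R - p. \<exists>k::nat. t \<otimes>\<^bsub>R\<^esub> x [^]\<^bsub>R\<^esub> k \<in> Idl\<^bsub>R\<^esub> (set zs)" if x: "x \<in> set xs" for x
    proof (rule ccontr)
      assume "\<not> ?thesis"
      then obtain Q where Q: "primeideal Q R" "Idl\<^bsub>R\<^esub> (set zs) \<subseteq> Q" "Q \<subseteq> p" "x \<notin> Q"
        using p.exists_prime_below[OF p p.genideal_ideal[OF carr(2)]] x carr(1) by blast
      then show False using zsQ[OF Q(1,3)] p.genideal_self[OF carr(2)] x by blast
    qed
    have "kexact (carrier R - p) (self_module R) (nth zs) {..<length zs} n"
      by (rule M.kexact_list_radical[OF carr _ _ rad ex]) (use p.I_prime in auto)
    then show False using top_koszul_not_exact[OF p zs(2)] zs(1) by simp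
  qed
  then obtain j where "j \<le> n" "koszul_H_nonzero (self_module R) xs j" by blast
  then show ?thesis
    unfolding enat Kgrade_list_def by (intro INF_lower2[of j]) auto
qed simp

text \<open>A list inside I lies inside every prime over I, so the bound for one list and one prime
  passes to the supremum over lists and the infimum over primes.\<close>

theorem Kgrade_le_ht:
  fixes R :: "'a ring"
  shows "Kgrade (self_module R) I \<le> ht R I"
  unfolding ht_def Kgrade_def
  by (intro INF_greatest SUP_least) (auto intro!: Kgrade_list_le_local_dim)

section \<open>Heights along a surjection with nil kernel\<close>

lemma (in primeideal) power_memD:
  assumes "r \<in> carrier R" "r [^] (n::nat) \<in> I"
  shows "r \<in> I"
  using assms(2)
proof (induction n)
  case 0
  then show ?case using one_imp_carrier assms(1) by simp
next
  case (Suc n)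
  then show ?case using I_prime[of "r [^] n" r] assms(1) by auto
qed

text \<open>Abstracts what the projection of the amalgamation onto \<open>A\<close> contributes to
  heights: image and preimage identify the primes on both sides together with their
  inclusions.\<close>

locale nil_surjection = ring_hom_cring R S h
  for R :: "'r ring" and S :: "'s ring" and h +
  assumes surj: "h ` carrier R = carrier S"
    and nil: "\<And>r. r \<in> carrier R \<Longrightarrow> h r = \<zero>\<^bsub>S\<^esub> \<Longrightarrow> \<exists>n::nat. r [^]\<^bsub>R\<^esub> n = \<zero>\<^bsub>R\<^esub>"
begin

text \<open>Elements with equal image differ by a nilpotent, and a nilpotent belongs to every
  prime.\<close>

lemma mem_prime_iff:
  assumes "primeideal Q R" "r \<in> carrier R"
  shows "h r \<in> h ` Q \<longleftrightarrow> r \<in> Q"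
proof
  interpret Q: primeideal Q R by fact
  assume "h r \<in> h ` Q"
  then obtain q where q: "q \<in> Q" "h r = h q" by auto
  have qc: "q \<in> carrier R" using q by auto
  have "h (r \<ominus>\<^bsub>R\<^esub> q) = \<zero>\<^bsub>S\<^esub>"
    using q qc assms(2) by (simp add: a_minus_def S.r_neg)
  then obtain n :: nat where "(r \<ominus>\<^bsub>R\<^esub> q) [^]\<^bsub>R\<^esub> n = \<zero>\<^bsub>R\<^esub>"
    using nil[of "r \<ominus>\<^bsub>R\<^esub> q"] qc assms(2) by auto
  then have "(r \<ominus>\<^bsub>R\<^esub> q) [^]\<^bsub>R\<^esub> n \<in> Q" using Q.zero_closed by simp
  then have "r \<ominus>\<^bsub>R\<^esub> q \<in> Q"
    by (rule Q.power_memD[rotated]) (use qc assms(2) in simp)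
  then show "r \<in> Q"
    using Q.add_mem_cancel[of r "\<ominus>\<^bsub>R\<^esub> q"] q assms(2) by (simp add: a_minus_def)
qed auto

lemma image_ideal:
  assumes "ideal I R"
  shows "ideal (h ` I) S"
proof (rule S.ideal_if_closed)
  interpret I: ideal I R by fact
  show "h ` I \<subseteq> carrier S" by auto
  show "\<zero>\<^bsub>S\<^esub> \<in> h ` I" using I.zero_closed hom_zero by (metis imageI)
  show "a \<oplus>\<^bsub>S\<^esub> b \<in> h ` I" if ab: "a \<in> h ` I" "b \<in> h ` I" for a b
  proof -
    obtain u v where "u \<in> I" "v \<in> I" "a = h u" "b = h v" using ab by auto
    then show ?thesis using I.a_closed[of u v] by (intro image_eqI[of _ _ "u \<oplus>\<^bsub>R\<^esub> v"]) auto
  qed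
  show "r \<otimes>\<^bsub>S\<^esub> a \<in> h ` I" if ar: "a \<in> h ` I" "r \<in> carrier S" for a r
  proof -
    obtain u s where "u \<in> I" "a = h u" "s \<in> carrier R" "r = h s" using ar surj by blast
    then show ?thesis using I.I_l_closed[of u s] by (intro image_eqI[of _ _ "s \<otimes>\<^bsub>R\<^esub> u"]) auto
  qed
qed

lemma image_primeideal:
  assumes "primeideal Q R"
  shows "primeideal (h ` Q) S"
proof (rule primeidealI)
  interpret Q: primeideal Q R by fact
  show "ideal (h ` Q) S" by (rule image_ideal[OF Q.is_ideal])
  show "carrier S \<noteq> h ` Q"
  proof
    assume "carrier S = h ` Q"
    then have "h \<one>\<^bsub>R\<^esub> \<in> h ` Q" using S.one_closed by simp
    then have "\<one>\<^bsub>R\<^esub> \<in> Q" using mem_prime_iff[OF assms R.one_closed] by blast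
    then show False using Q.one_imp_carrier Q.I_notcarr by auto
  qed
  fix a b assume ab: "a \<in> carrier S" "b \<in> carrier S" "a \<otimes>\<^bsub>S\<^esub> b \<in> h ` Q"
  then obtain u v where uv: "u \<in> carrier R" "v \<in> carrier R" "a = h u" "b = h v"
    using surj by (metis imageE)
  then have "u \<otimes>\<^bsub>R\<^esub> v \<in> Q" using ab mem_prime_iff[OF assms, of "u \<otimes>\<^bsub>R\<^esub> v"] by simp
  then show "a \<in> h ` Q \<or> b \<in> h ` Q" using Q.I_prime uv by blast
qed (rule S.is_cring)

lemma vimage_primeideal: "primeideal P S \<Longrightarrow> primeideal {r \<in> carrier R. h r \<in> P} R"
  using ring_hom_ring.primeideal_vimage[OF ring_hom_ringI2[OF R.ring_axioms S.ring_axioms homh] R.is_cring] .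

lemma image_vimage: "P \<subseteq> carrier S \<Longrightarrow> h ` {r \<in> carrier R. h r \<in> P} = P"
proof (intro equalityI subsetI)
  fix a assume P: "P \<subseteq> carrier S" "a \<in> P"
  then obtain r where "r \<in> carrier R" "h r = a" using surj by (metis imageE subsetD)
  then show "a \<in> h ` {r \<in> carrier R. h r \<in> P}" using P by blast
qed auto

lemma vimage_image: "primeideal Q R \<Longrightarrow> {r \<in> carrier R. h r \<in> h ` Q} = Q"
  using mem_prime_iff[of Q] ideal.Icarr[OF primeideal.axioms(1), of Q R] by blast

text \<open>Chains pass to S by images and return by preimages; strictness survives because the two
  are inverse to each other on primes.\<close>

lemma local_dim_image:
  assumes Q: "primeideal Q R"
  shows "local_dim R Q = local_dim S (h ` Q)"
proof -
  have "(\<exists>C. (\<forall>k\<le>n. primeideal (C k) R) \<and> (\<forall>k<n. C k \<subset> C (Suc k)) \<and> C n = Q)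
     \<longleftrightarrow> (\<exists>C. (\<forall>k\<le>n. primeideal (C k) S) \<and> (\<forall>k<n. C k \<subset> C (Suc k)) \<and> C n = h ` Q)"
    (is "(\<exists>C. ?L C) \<longleftrightarrow> (\<exists>C. ?R C)") for n
  proof
    assume "\<exists>C. ?L C"
    then obtain C where C: "?L C" ..
    have "h ` C k \<subset> h ` C (Suc k)" if "k < n" for k
    proof -
      have "primeideal (C k) R" "primeideal (C (Suc k)) R" "C k \<subset> C (Suc k)" using C that by auto
      then show ?thesis using vimage_image[of "C k"] vimage_image[of "C (Suc k)"] by blast
    qed
    then have "?R (\<lambda>k. h ` C k)" using C image_primeideal by auto
    then show "\<exists>C. ?R C" by (rule exI[where x = "\<lambda>k. h ` C k"])
  next
    assume "\<exists>C. ?R C"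
    then obtain C where C: "?R C" ..
    let ?D = "\<lambda>k. {r \<in> carrier R. h r \<in> C k}"
    have "?D k \<subset> ?D (Suc k)" if "k < n" for k
    proof -
      have "primeideal (C k) S" "primeideal (C (Suc k)) S" and lt: "C k \<subset> C (Suc k)" using C that by auto
      then have "C k \<subseteq> carrier S" "C (Suc k) \<subseteq> carrier S"
        by (auto dest: ideal.Icarr primeideal.axioms(1))
      then have "h ` ?D k = C k" "h ` ?D (Suc k) = C (Suc k)" by (simp_all add: image_vimage)
      then have "?D k \<noteq> ?D (Suc k)" using lt by (metis psubsetE order_refl)
      then show ?thesis using lt by blast
    qed
    then have "?L ?D" using C vimage_primeideal vimage_image[OF Q] by auto
    then show "\<exists>C. ?L C" by (rule exI[where x = ?D])
  qed
  then show ?thesis by (simp add: local_dim_def)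
qed

lemma ht_image:
  assumes "ideal I R"
  shows "ht R I = ht S (h ` I)"
proof -
  have "local_dim R ` {Q. primeideal Q R \<and> I \<subseteq> Q} = local_dim S ` {P. primeideal P S \<and> h ` I \<subseteq> P}"
  proof (intro equalityI subsetI)
    fix d assume "d \<in> local_dim R ` {Q. primeideal Q R \<and> I \<subseteq> Q}"
    then obtain Q where "primeideal Q R" "I \<subseteq> Q" "d = local_dim R Q" by auto
    then show "d \<in> local_dim S ` {P. primeideal P S \<and> h ` I \<subseteq> P}"
      using local_dim_image image_primeideal by blast
  next
    fix d assume "d \<in> local_dim S ` {P. primeideal P S \<and> h ` I \<subseteq> P}"
    then obtain P where P: "primeideal P S" "h ` I \<subseteq> P" "d = local_dim S P" by auto
    let ?Q = "{r \<in> carrier R. h r \<in> P}"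
    have "P \<subseteq> carrier S" using P(1) by (auto dest: ideal.Icarr primeideal.axioms(1))
    then have "local_dim R ?Q = d"
      using local_dim_image[OF vimage_primeideal[OF P(1)]] P(3) by (simp add: image_vimage)
    moreover have "I \<subseteq> ?Q" using P(2) ideal.Icarr[OF assms] by auto
    ultimately show "d \<in> local_dim R ` {Q. primeideal Q R \<and> I \<subseteq> Q}"
      using vimage_primeideal[OF P(1)] by blast
  qed
  then show ?thesis by (simp add: ht_def)
qed

end

text \<open>Write v = u + z: modulo u the powers of v are those of z, so v^n is a multiple of u once
  z^n = 0.\<close>

lemma (in cring) power_multiple_if_diff_nilpotent:
  assumes u: "u \<in> carrier R" and v: "v \<in> carrier R" and n: "(v \<ominus> u) [^] (n::nat) = \<zero>"
  shows "\<exists>r\<in>carrier R. v [^] n = r \<otimes> u"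
proof -
  define z where "z = v \<ominus> u"
  have z: "z \<in> carrier R" using u v by (simp add: z_def)
  have "u \<oplus> (v \<oplus> \<ominus> u) = v \<oplus> (u \<oplus> \<ominus> u)"
    using u v by (simp add: a_ac)
  then have vz: "v = u \<oplus> z"
    using u v by (simp add: z_def a_minus_def r_neg)
  have "\<exists>r\<in>carrier R. v [^] m = r \<otimes> u \<oplus> z [^] m" for m :: nat
  proof (induction m)
    case 0
    show ?case using u by (intro bexI[of _ \<zero>]) auto
  next
    case (Suc m)
    then obtain r where r: "r \<in> carrier R" "v [^] m = r \<otimes> u \<oplus> z [^] m" by blast
    have "v [^] Suc m = (r \<otimes> u \<oplus> z [^] m) \<otimes> (u \<oplus> z)"
      using r(2) vz by simp
    also have "\<dots> = (r \<otimes> (u \<oplus> z) \<oplus> z [^] m) \<otimes> u \<oplus> z [^] Suc m"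
      using r u z by (simp add: l_distr r_distr m_ac a_ac)
    finally show ?case using r u z by blast
  qed
  from this[of n] obtain r where "r \<in> carrier R" "v [^] n = r \<otimes> u \<oplus> z [^] n" by blast
  then show ?thesis using n u by (auto simp: z_def)
qed

section \<open>The amalgamation\<close>

text \<open>Linearity is asked only for matching entries of two lists, because the modules to be
  compared have different base rings: the amalgamation over itself, \<open>A\<close> and
  \<open>J\<close> over \<open>A\<close>.\<close>

definition klinear :: "('r, 'm) module \<Rightarrow> ('s, 'n) module \<Rightarrow> 'r list \<Rightarrow> 's list \<Rightarrow> ('m \<Rightarrow> 'n) \<Rightarrow> bool" where
  "klinear M N xs ys h \<longleftrightarrow> abelian_group_hom M N h \<and> length xs = length ys \<and>
     (\<forall>t<length xs. \<forall>v\<in>carrier M. xs ! t \<odot>\<^bsub>M\<^esub> v \<in> carrier M \<and> h (xs ! t \<odot>\<^bsub>M\<^esub> v) = ys ! t \<odot>\<^bsub>N\<^esub> h v)"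

lemma klinear_kdiff:
  assumes "klinear M N xs ys h" "\<And>S. c S \<in> carrier M"
  shows "kdiff N (nth ys) {..<length ys} (\<lambda>S. h (c S)) = (\<lambda>T. h (kdiff M (nth xs) {..<length xs} c T))"
proof -
  have "abelian_group_hom M N h" and len: "length ys = length xs"
    using assms(1) by (auto simp: klinear_def)
  then show ?thesis
    unfolding len by (intro kdiff_hom) (use assms in \<open>auto simp: klinear_def\<close>)
qed

lemma klinear_kcochains:
  assumes "klinear M N xs ys h" "c \<in> kcochains M \<Lambda> n"
  shows "(\<lambda>S. h (c S)) \<in> kcochains N \<Lambda> n"
proof -
  interpret abelian_group_hom M N h using assms(1) by (simp add: klinear_def)
  show ?thesis using assms(2) hom_zero by (simp add: kcochains_def)
qed

lemma klinear_zero: "klinear M N xs ys h \<Longrightarrow> h \<zero>\<^bsub>M\<^esub> = \<zero>\<^bsub>N\<^esub>"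
  unfolding klinear_def by (blast intro: abelian_group_hom.hom_zero)

lemma koszul_H_nonzero_kdiff:
  assumes "Module.module R M" "set xs \<subseteq> carrier R"
  shows "koszul_H_nonzero M xs i \<longleftrightarrow>
    (\<exists>c \<in> kcochains M {..<length xs} (Suc i). kdiff M (nth xs) {..<length xs} c = (\<lambda>_. \<zero>\<^bsub>M\<^esub>) \<and>
       (\<nexists>b. b \<in> kcochains M {..<length xs} i \<and> kdiff M (nth xs) {..<length xs} b = c))"
proof -
  interpret Module.module R M by fact
  have one: "(\<lambda>T. \<one>\<^bsub>R\<^esub> \<odot>\<^bsub>M\<^esub> c T) = c" if "c \<in> kcochains M {..<length xs} (Suc i)" for c
    using kcochains_closed[OF that] by simp
  show ?thesis
    unfolding koszul_H_nonzero_iff[OF assms] kexact_def using one by auto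
qed

text \<open>i and p make N a direct summand of M: if the image of a class under i is bounded in M,
  then p carries that bound back to N.\<close>

lemma koszul_H_nonzero_retract:
  assumes M: "Module.module R M" "set xs \<subseteq> carrier R" and N: "Module.module S N" "set ys \<subseteq> carrier S"
    and i: "klinear N M ys xs i" and p: "klinear M N xs ys p" and pi: "\<And>v. v \<in> carrier N \<Longrightarrow> p (i v) = v"
    and H: "koszul_H_nonzero N ys k"
  shows "koszul_H_nonzero M xs k"
proof -
  interpret M: Module.module R M by fact
  interpret N: Module.module S N by fact
  have len: "length xs = length ys" using p by (simp add: klinear_def)
  obtain c where c: "c \<in> kcochains N {..<length ys} (Suc k)"
    and dc: "kdiff N (nth ys) {..<length ys} c = (\<lambda>_. \<zero>\<^bsub>N\<^esub>)"
    and nb: "\<And>b. b \<in> kcochains N {..<length ys} k \<Longrightarrow> kdiff N (nth ys) {..<length ys} b \<noteq> c"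
    using H koszul_H_nonzero_kdiff[OF N] by blast
  note cc = N.kcochains_closed[OF c]
  have "(\<lambda>S. i (c S)) \<in> kcochains M {..<length xs} (Suc k)"
    using klinear_kcochains[OF i c] len by simp
  moreover have "kdiff M (nth xs) {..<length xs} (\<lambda>S. i (c S)) = (\<lambda>_. \<zero>\<^bsub>M\<^esub>)"
    using klinear_kdiff[OF i, of c] cc dc klinear_zero[OF i] by simp
  moreover have "kdiff M (nth xs) {..<length xs} b \<noteq> (\<lambda>S. i (c S))"
    if b: "b \<in> kcochains M {..<length xs} k" for b
  proof
    assume "kdiff M (nth xs) {..<length xs} b = (\<lambda>S. i (c S))"
    then have "kdiff N (nth ys) {..<length ys} (\<lambda>S. p (b S)) = c"
      using klinear_kdiff[OF p, of b] M.kcochains_closed[OF b] pi cc by simp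
    then show False using nb klinear_kcochains[OF p b] len by simp
  qed
  ultimately show ?thesis using koszul_H_nonzero_kdiff[OF M] by blast
qed

text \<open>A cocycle of M is the sum of its components from N and L; if both components are
  boundaries, so is the cocycle.\<close>

lemma koszul_H_nonzero_split:
  assumes M: "Module.module R M" "set xs \<subseteq> carrier R"
    and N: "Module.module S N" "set ys \<subseteq> carrier S" and L: "Module.module T L" "set zs \<subseteq> carrier T"
    and i: "klinear N M ys xs i" "klinear L M zs xs i'"
    and p: "klinear M N xs ys p" "klinear M L xs zs p'"
    and ip: "\<And>v. v \<in> carrier M \<Longrightarrow> i (p v) \<oplus>\<^bsub>M\<^esub> i' (p' v) = v"
    and H: "koszul_H_nonzero M xs k"
  shows "koszul_H_nonzero N ys k \<or> koszul_H_nonzero L zs k"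
proof (rule ccontr)
  interpret M: Module.module R M by fact
  interpret N: Module.module S N by fact
  interpret L: Module.module T L by fact
  have len: "length ys = length xs" "length zs = length xs" using p by (simp_all add: klinear_def)
  have x: "nth xs ` {..<length xs} \<subseteq> carrier R" using M(2) by auto
  obtain c where c: "c \<in> kcochains M {..<length xs} (Suc k)"
    and dc: "kdiff M (nth xs) {..<length xs} c = (\<lambda>_. \<zero>\<^bsub>M\<^esub>)"
    and nb: "\<And>b. b \<in> kcochains M {..<length xs} k \<Longrightarrow> kdiff M (nth xs) {..<length xs} b \<noteq> c"
    using H koszul_H_nonzero_kdiff[OF M] by blast
  note cc = M.kcochains_closed[OF c]
  assume n: "\<not> ?thesis"
  have "kdiff N (nth ys) {..<length ys} (\<lambda>S. p (c S)) = (\<lambda>_. \<zero>\<^bsub>N\<^esub>)"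
    using klinear_kdiff[OF p(1), of c] cc dc klinear_zero[OF p(1)] by simp
  then obtain b where b: "b \<in> kcochains N {..<length ys} k"
    and db: "kdiff N (nth ys) {..<length ys} b = (\<lambda>S. p (c S))"
    using n koszul_H_nonzero_kdiff[OF N] klinear_kcochains[OF p(1) c] len by metis
  have "kdiff L (nth zs) {..<length zs} (\<lambda>S. p' (c S)) = (\<lambda>_. \<zero>\<^bsub>L\<^esub>)"
    using klinear_kdiff[OF p(2), of c] cc dc klinear_zero[OF p(2)] by simp
  then obtain b' where b': "b' \<in> kcochains L {..<length zs} k"
    and db': "kdiff L (nth zs) {..<length zs} b' = (\<lambda>S. p' (c S))"
    using n koszul_H_nonzero_kdiff[OF L] klinear_kcochains[OF p(2) c] len by metis
  have k: "(\<lambda>S. i (b S)) \<in> kcochains M {..<length xs} k" "(\<lambda>S. i' (b' S)) \<in> kcochains M {..<length xs} k"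
    using klinear_kcochains[OF i(1) b] klinear_kcochains[OF i(2) b'] len by simp_all
  have "kdiff M (nth xs) {..<length xs} (\<lambda>S. i (b S) \<oplus>\<^bsub>M\<^esub> i' (b' S)) = (\<lambda>S. i (p (c S)) \<oplus>\<^bsub>M\<^esub> i' (p' (c S)))"
    unfolding M.kdiff_add[OF M.kcochains_closed[OF k(1)] M.kcochains_closed[OF k(2)] x]
    using klinear_kdiff[OF i(1), of b] klinear_kdiff[OF i(2), of b'] db db'
      N.kcochains_closed[OF b] L.kcochains_closed[OF b'] by simp
  also have "\<dots> = c" using ip cc by simp
  finally show False using nb M.kcochains_add[OF k] by blast
qed

section \<open>The ring structure of the amalgamation and the \<open>A\<close>-module
  \<open>J\<close>\<close>

locale amalgamation = H: ring_hom_cring A B f + J: ideal J B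
  for A :: "'a ring" and B :: "'b ring" and f :: "'a \<Rightarrow> 'b" and J :: "'b set"
begin

abbreviation "R \<equiv> amalg A B f J"

lemma amalg_simps [simp]:
  "x \<otimes>\<^bsub>R\<^esub> y = (fst x \<otimes>\<^bsub>A\<^esub> fst y, snd x \<otimes>\<^bsub>B\<^esub> snd y)"
  "x \<oplus>\<^bsub>R\<^esub> y = (fst x \<oplus>\<^bsub>A\<^esub> fst y, snd x \<oplus>\<^bsub>B\<^esub> snd y)"
  "\<one>\<^bsub>R\<^esub> = (\<one>\<^bsub>A\<^esub>, \<one>\<^bsub>B\<^esub>)" "\<zero>\<^bsub>R\<^esub> = (\<zero>\<^bsub>A\<^esub>, \<zero>\<^bsub>B\<^esub>)"
  by (simp_all add: amalg_def)

text \<open>Trading the existential over j for a condition on b - f a lets membership be used by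
  rewriting.\<close>

lemma carrier_amalg_iff:
  "(a, b) \<in> carrier R \<longleftrightarrow> a \<in> carrier A \<and> b \<in> carrier B \<and> b \<ominus>\<^bsub>B\<^esub> f a \<in> J"
proof
  assume "(a, b) \<in> carrier R"
  then obtain j where "a \<in> carrier A" "j \<in> J" "b = f a \<oplus>\<^bsub>B\<^esub> j" by (auto simp: amalg_def)
  then show "a \<in> carrier A \<and> b \<in> carrier B \<and> b \<ominus>\<^bsub>B\<^esub> f a \<in> J"
    using J.Icarr[of j] by (simp add: a_minus_def H.S.a_ac H.S.r_neg H.S.a_assoc[symmetric])
next
  assume r: "a \<in> carrier A \<and> b \<in> carrier B \<and> b \<ominus>\<^bsub>B\<^esub> f a \<in> J"
  then have "f a \<oplus>\<^bsub>B\<^esub> (b \<ominus>\<^bsub>B\<^esub> f a) = b \<oplus>\<^bsub>B\<^esub> (f a \<oplus>\<^bsub>B\<^esub> \<ominus>\<^bsub>B\<^esub> f a)"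
    by (simp add: a_minus_def H.S.a_ac)
  then have "b = f a \<oplus>\<^bsub>B\<^esub> (b \<ominus>\<^bsub>B\<^esub> f a)" using r by (simp add: H.S.r_neg)
  then show "(a, b) \<in> carrier R" using r by (auto simp: amalg_def)
qed

lemma amalg_carrierI: "a \<in> carrier A \<Longrightarrow> j \<in> J \<Longrightarrow> (a, f a \<oplus>\<^bsub>B\<^esub> j) \<in> carrier R"
  by (auto simp: amalg_def)

lemma amalg_carrierE:
  assumes "r \<in> carrier R"
  obtains a j where "a \<in> carrier A" "j \<in> J" "r = (a, f a \<oplus>\<^bsub>B\<^esub> j)"
  using assms by (auto simp: amalg_def)

lemma amalg_cring: "cring R"
proof (rule cringI)
  show "abelian_group R"
  proof (rule abelian_groupI)
    fix x y assume "x \<in> carrier R" "y \<in> carrier R"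
    then obtain a j b k where aj: "a \<in> carrier A" "j \<in> J" "b \<in> carrier A" "k \<in> J"
      "x = (a, f a \<oplus>\<^bsub>B\<^esub> j)" "y = (b, f b \<oplus>\<^bsub>B\<^esub> k)" by (elim amalg_carrierE) blast
    have jk: "j \<in> carrier B" "k \<in> carrier B" using aj J.Icarr by auto
    have "x \<oplus>\<^bsub>R\<^esub> y = (a \<oplus>\<^bsub>A\<^esub> b, f (a \<oplus>\<^bsub>A\<^esub> b) \<oplus>\<^bsub>B\<^esub> (j \<oplus>\<^bsub>B\<^esub> k))"
      using aj jk by (simp add: H.S.a_ac)
    moreover have "\<dots> \<in> carrier R" using aj by (intro amalg_carrierI) auto
    ultimately show "x \<oplus>\<^bsub>R\<^esub> y \<in> carrier R" by (simp only:)
    show "x \<oplus>\<^bsub>R\<^esub> y = y \<oplus>\<^bsub>R\<^esub> x" using aj jk by (simp add: H.S.a_ac H.R.a_ac)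
  next
    show "\<zero>\<^bsub>R\<^esub> \<in> carrier R" using carrier_amalg_iff by (simp add: a_minus_def)
  next
    fix x y z assume "x \<in> carrier R" "y \<in> carrier R" "z \<in> carrier R"
    then show "x \<oplus>\<^bsub>R\<^esub> y \<oplus>\<^bsub>R\<^esub> z = x \<oplus>\<^bsub>R\<^esub> (y \<oplus>\<^bsub>R\<^esub> z)"
      by (cases x, cases y, cases z) (simp add: carrier_amalg_iff H.S.a_assoc H.R.a_assoc)
  next
    fix x assume "x \<in> carrier R"
    then show "\<zero>\<^bsub>R\<^esub> \<oplus>\<^bsub>R\<^esub> x = x" by (cases x) (simp add: carrier_amalg_iff)
  next
    fix x assume "x \<in> carrier R"
    then obtain a j where aj: "a \<in> carrier A" "j \<in> J" "x = (a, f a \<oplus>\<^bsub>B\<^esub> j)" by (elim amalg_carrierE)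
    have jc: "j \<in> carrier B" using aj J.Icarr by auto
    have "(\<ominus>\<^bsub>A\<^esub> a, f (\<ominus>\<^bsub>A\<^esub> a) \<oplus>\<^bsub>B\<^esub> \<ominus>\<^bsub>B\<^esub> j) \<oplus>\<^bsub>R\<^esub> x = \<zero>\<^bsub>R\<^esub>"
      using aj jc by (simp add: H.R.l_neg H.S.minus_add[symmetric] H.S.l_neg)
    moreover have "(\<ominus>\<^bsub>A\<^esub> a, f (\<ominus>\<^bsub>A\<^esub> a) \<oplus>\<^bsub>B\<^esub> \<ominus>\<^bsub>B\<^esub> j) \<in> carrier R"
      using aj by (intro amalg_carrierI) auto
    ultimately show "\<exists>y\<in>carrier R. y \<oplus>\<^bsub>R\<^esub> x = \<zero>\<^bsub>R\<^esub>" by blast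
  qed
  show "comm_monoid R"
  proof (rule comm_monoidI)
    fix x y assume "x \<in> carrier R" "y \<in> carrier R"
    then obtain a j b k where aj: "a \<in> carrier A" "j \<in> J" "b \<in> carrier A" "k \<in> J"
      "x = (a, f a \<oplus>\<^bsub>B\<^esub> j)" "y = (b, f b \<oplus>\<^bsub>B\<^esub> k)" by (elim amalg_carrierE) blast
    have jk: "j \<in> carrier B" "k \<in> carrier B" using aj J.Icarr by auto
    have "x \<otimes>\<^bsub>R\<^esub> y = (a \<otimes>\<^bsub>A\<^esub> b, f (a \<otimes>\<^bsub>A\<^esub> b) \<oplus>\<^bsub>B\<^esub> (f a \<otimes>\<^bsub>B\<^esub> k \<oplus>\<^bsub>B\<^esub> (f b \<oplus>\<^bsub>B\<^esub> k) \<otimes>\<^bsub>B\<^esub> j))"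
      using aj jk by (simp add: H.S.a_ac H.S.m_ac H.S.l_distr H.S.r_distr)
    \<comment> \<open>Besides f (a b), every term of the product has a factor j or k, so absorption
      by the ideal \<open>J\<close> keeps the remainder in \<open>J\<close>.\<close>
    moreover have "f a \<otimes>\<^bsub>B\<^esub> k \<oplus>\<^bsub>B\<^esub> (f b \<oplus>\<^bsub>B\<^esub> k) \<otimes>\<^bsub>B\<^esub> j \<in> J"
      using aj jk by (intro J.a_closed J.I_l_closed) auto
    then have "(a \<otimes>\<^bsub>A\<^esub> b, f (a \<otimes>\<^bsub>A\<^esub> b) \<oplus>\<^bsub>B\<^esub> (f a \<otimes>\<^bsub>B\<^esub> k \<oplus>\<^bsub>B\<^esub> (f b \<oplus>\<^bsub>B\<^esub> k) \<otimes>\<^bsub>B\<^esub> j)) \<in> carrier R"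
      using aj by (intro amalg_carrierI) auto
    ultimately show "x \<otimes>\<^bsub>R\<^esub> y \<in> carrier R" by (simp only:)
    show "x \<otimes>\<^bsub>R\<^esub> y = y \<otimes>\<^bsub>R\<^esub> x" using aj jk by (simp add: H.S.m_comm H.R.m_comm)
  next
    show "\<one>\<^bsub>R\<^esub> \<in> carrier R" using carrier_amalg_iff by (simp add: a_minus_def H.S.r_neg)
  next
    fix x y z assume "x \<in> carrier R" "y \<in> carrier R" "z \<in> carrier R"
    then show "x \<otimes>\<^bsub>R\<^esub> y \<otimes>\<^bsub>R\<^esub> z = x \<otimes>\<^bsub>R\<^esub> (y \<otimes>\<^bsub>R\<^esub> z)"
      by (cases x, cases y, cases z) (simp add: carrier_amalg_iff H.S.m_assoc H.R.m_assoc)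
  next
    fix x assume "x \<in> carrier R"
    then show "\<one>\<^bsub>R\<^esub> \<otimes>\<^bsub>R\<^esub> x = x" by (cases x) (simp add: carrier_amalg_iff)
  qed
  fix x y z assume "x \<in> carrier R" "y \<in> carrier R" "z \<in> carrier R"
  then show "(x \<oplus>\<^bsub>R\<^esub> y) \<otimes>\<^bsub>R\<^esub> z = x \<otimes>\<^bsub>R\<^esub> z \<oplus>\<^bsub>R\<^esub> y \<otimes>\<^bsub>R\<^esub> z"
    by (cases x, cases y, cases z) (simp add: carrier_amalg_iff H.S.l_distr H.R.l_distr)
qed

lemma induced_module_simps [simp]:
  "carrier (induced_module B f J) = J" "\<zero>\<^bsub>induced_module B f J\<^esub> = \<zero>\<^bsub>B\<^esub>"
  "add (induced_module B f J) = add B" "a \<odot>\<^bsub>induced_module B f J\<^esub> j = f a \<otimes>\<^bsub>B\<^esub> j"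
  by (simp_all add: induced_module_def)

lemma induced_module_is_module: "Module.module A (induced_module B f J)"
proof (rule moduleI[OF H.R.is_cring])
  show "abelian_group (induced_module B f J)"
  proof (rule abelian_groupI)
    fix x assume "x \<in> carrier (induced_module B f J)"
    then show "\<exists>y\<in>carrier (induced_module B f J). y \<oplus>\<^bsub>induced_module B f J\<^esub> x = \<zero>\<^bsub>induced_module B f J\<^esub>"
      using J.a_inv_closed[of x] J.Icarr[of x] by (auto intro!: bexI[of _ "\<ominus>\<^bsub>B\<^esub> x"] H.S.l_neg)
  qed (auto simp: J.Icarr H.S.a_assoc intro: H.S.a_comm)
qed (auto simp: J.Icarr H.S.l_distr H.S.r_distr H.S.m_assoc intro: J.I_l_closed)

definition emb :: "'a \<Rightarrow> 'a \<times> 'b" where "emb a = (a, f a)"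

lemma emb_closed: "a \<in> carrier A \<Longrightarrow> emb a \<in> carrier R"
  by (simp add: emb_def carrier_amalg_iff a_minus_def H.S.r_neg)

end

section \<open>Koszul grade of the amalgamation along a nil ideal\<close>

locale nil_amalgamation = amalgamation +
  assumes J_nil: "J \<subseteq> nilrad B"
begin

lemma fst_nil_surjection: "nil_surjection R A fst"
proof -
  interpret R: cring R by (rule amalg_cring)
  interpret fst: ring_hom_cring R A fst
  proof (intro ring_hom_cring.intro ring_hom_cring_axioms.intro amalg_cring H.R.is_cring)
    show "fst \<in> ring_hom R A"
      by (rule ring_hom_memI) (auto simp: carrier_amalg_iff)
  qed
  show ?thesis
  proof
    show "fst ` carrier R = carrier A"
    proof (intro equalityI subsetI)
      fix a assume "a \<in> carrier A"
      then show "a \<in> fst ` carrier R" using emb_closed by (force simp: emb_def)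
    qed (auto simp: carrier_amalg_iff)
    fix r assume r: "r \<in> carrier R" "fst r = \<zero>\<^bsub>A\<^esub>"
    obtain b where b: "r = (\<zero>\<^bsub>A\<^esub>, b)" using r by (cases r) auto
    then have "b \<in> carrier B" "b \<ominus>\<^bsub>B\<^esub> \<zero>\<^bsub>B\<^esub> \<in> J" using r by (auto simp: carrier_amalg_iff)
    then have bJ: "b \<in> J" by (simp add: a_minus_def H.S.minus_zero)
    then obtain n :: nat where n: "b [^]\<^bsub>B\<^esub> n = \<zero>\<^bsub>B\<^esub>" using J_nil by (auto simp: nilrad_def)
    have pow: "r [^]\<^bsub>R\<^esub> m = (\<zero>\<^bsub>A\<^esub> [^]\<^bsub>A\<^esub> m, b [^]\<^bsub>B\<^esub> m)" for m :: nat
      by (induction m) (simp_all add: b)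
    \<comment> \<open>The exponent has to be positive for the first component, since 0^0 = 1 in
      \<open>A\<close>.\<close>
    have "r [^]\<^bsub>R\<^esub> Suc n = \<zero>\<^bsub>R\<^esub>"
      unfolding pow using n J.Icarr[OF bJ] by simp
    then show "\<exists>n::nat. r [^]\<^bsub>R\<^esub> n = \<zero>\<^bsub>R\<^esub>" by blast
  qed
qed

text \<open>The difference lies in 0 x J and is nilpotent. By symmetry u and v generate ideals with
  the same radical, so elements of the amalgamation can be traded for values of
  \<open>emb\<close>.\<close>

lemma power_multiple_if_fst_eq:
  assumes "u \<in> carrier R" "v \<in> carrier R" "fst u = fst v"
  shows "\<exists>n::nat. \<exists>r\<in>carrier R. v [^]\<^bsub>R\<^esub> n = r \<otimes>\<^bsub>R\<^esub> u"
proof -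
  interpret F: nil_surjection R A fst by (rule fst_nil_surjection)
  have "fst (v \<ominus>\<^bsub>R\<^esub> u) = \<zero>\<^bsub>A\<^esub>"
    using assms F.hom_closed[of v] by (simp add: a_minus_def F.hom_add H.R.r_neg del: amalg_simps)
  then obtain n :: nat where "(v \<ominus>\<^bsub>R\<^esub> u) [^]\<^bsub>R\<^esub> n = \<zero>\<^bsub>R\<^esub>"
    using F.nil[of "v \<ominus>\<^bsub>R\<^esub> u"] assms by auto
  then show ?thesis using F.R.power_multiple_if_diff_nilpotent[OF assms(1,2)] by blast
qed

text \<open>With scalars acting through \<open>emb\<close>, the Koszul complex of the amalgamation
  is the direct sum of those of \<open>A\<close> and \<open>J\<close>; the four maps below are its
  inclusions and projections.\<close>

lemma koszul_H_nonzero_amalg_iff: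
  assumes xs: "set xs \<subseteq> carrier A"
  shows "koszul_H_nonzero (self_module R) (map emb xs) k \<longleftrightarrow>
    koszul_H_nonzero (self_module A) xs k \<or> koszul_H_nonzero (induced_module B f J) xs k"
proof -
  let ?RM = "self_module R" and ?AM = "self_module A" and ?JM = "induced_module B f J"
  interpret R: cring R by (rule amalg_cring)
  interpret RM: Module.module R ?RM by (rule self_module_is_module[OF amalg_cring])
  interpret AM: Module.module A ?AM by (rule self_module_is_module[OF H.R.is_cring])
  interpret JM: Module.module A ?JM by (rule induced_module_is_module)
  have x: "xs ! t \<in> carrier A" if "t < length xs" for t using xs that by auto
  have ex: "set (map emb xs) \<subseteq> carrier R" using xs emb_closed by auto
  have scal: "emb a \<otimes>\<^bsub>R\<^esub> v \<in> carrier R" if "a \<in> carrier A" "v \<in> carrier R" for a v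
    using that emb_closed by (intro R.m_closed)
  have i: "klinear ?AM ?RM xs (map emb xs) emb"
    unfolding klinear_def
  proof (intro conjI allI impI ballI)
    show "abelian_group_hom ?AM ?RM emb"
      by (rule abelian_group_hom_if_additive[OF AM.abelian_group_axioms RM.abelian_group_axioms])
        (auto simp: emb_closed, auto simp: emb_def)
  qed (auto simp: x, auto simp: emb_def x)
  have inJ: "(\<zero>\<^bsub>A\<^esub>, j) \<in> carrier R" if "j \<in> J" for j
    using amalg_carrierI[of "\<zero>\<^bsub>A\<^esub>" j] J.Icarr[OF that] that by simp
  have i': "klinear ?JM ?RM xs (map emb xs) (\<lambda>j. (\<zero>\<^bsub>A\<^esub>, j))"
    unfolding klinear_def
  proof (intro conjI allI impI ballI)
    show "abelian_group_hom ?JM ?RM (\<lambda>j. (\<zero>\<^bsub>A\<^esub>, j))"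
      by (rule abelian_group_hom_if_additive[OF JM.abelian_group_axioms RM.abelian_group_axioms])
        (auto simp: inJ)
  qed (auto simp: x J.I_l_closed emb_def)
  have fst: "fst r \<in> carrier A" "snd r \<in> carrier B" "snd r \<ominus>\<^bsub>B\<^esub> f (fst r) \<in> J" if "r \<in> carrier R" for r
    using that by (cases r, simp add: carrier_amalg_iff)+
  have p: "klinear ?RM ?AM (map emb xs) xs fst"
    unfolding klinear_def
  proof (intro conjI allI impI ballI)
    show "abelian_group_hom ?RM ?AM fst"
      by (rule abelian_group_hom_if_additive[OF RM.abelian_group_axioms AM.abelian_group_axioms])
        (auto simp: fst)
  next
    fix t v assume "t < length (map emb xs)" "v \<in> carrier ?RM"
    then show "map emb xs ! t \<odot>\<^bsub>?RM\<^esub> v \<in> carrier ?RM" using scal[of "xs ! t" v] x by simp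
  qed (auto simp: emb_def)
  \<comment> \<open>The projection onto \<open>J\<close> subtracts the part coming from
    \<open>A\<close>. It respects scalars because \<open>emb\<close> a multiplies second components
    by f a.\<close>
  have p': "klinear ?RM ?JM (map emb xs) xs (\<lambda>r. snd r \<ominus>\<^bsub>B\<^esub> f (fst r))"
    unfolding klinear_def
  proof (intro conjI allI impI ballI)
    show "abelian_group_hom ?RM ?JM (\<lambda>r. snd r \<ominus>\<^bsub>B\<^esub> f (fst r))"
    proof (rule abelian_group_hom_if_additive[OF RM.abelian_group_axioms JM.abelian_group_axioms])
      fix v w assume "v \<in> carrier ?RM" "w \<in> carrier ?RM"
      then show "snd (v \<oplus>\<^bsub>?RM\<^esub> w) \<ominus>\<^bsub>B\<^esub> f (fst (v \<oplus>\<^bsub>?RM\<^esub> w))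
          = (snd v \<ominus>\<^bsub>B\<^esub> f (fst v)) \<oplus>\<^bsub>?JM\<^esub> (snd w \<ominus>\<^bsub>B\<^esub> f (fst w))"
        using fst[of v] fst[of w] by (simp add: a_minus_def H.S.minus_add H.S.a_ac)
    qed (auto simp: fst)
  next
    fix t v assume t: "t < length (map emb xs)" and v: "v \<in> carrier ?RM"
    then show "map emb xs ! t \<odot>\<^bsub>?RM\<^esub> v \<in> carrier ?RM" using scal[of "xs ! t" v] x by simp
    show "snd (map emb xs ! t \<odot>\<^bsub>?RM\<^esub> v) \<ominus>\<^bsub>B\<^esub> f (fst (map emb xs ! t \<odot>\<^bsub>?RM\<^esub> v))
        = xs ! t \<odot>\<^bsub>?JM\<^esub> (snd v \<ominus>\<^bsub>B\<^esub> f (fst v))"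
      using t v x[of t] fst[of v]
      by (simp add: emb_def a_minus_def H.S.r_distr H.S.r_minus)
  qed auto
  have ip: "emb (fst v) \<oplus>\<^bsub>?RM\<^esub> (\<zero>\<^bsub>A\<^esub>, snd v \<ominus>\<^bsub>B\<^esub> f (fst v)) = v" if v: "v \<in> carrier ?RM" for v
  proof -
    obtain a j where "a \<in> carrier A" "j \<in> J" "v = (a, f a \<oplus>\<^bsub>B\<^esub> j)"
      by (rule amalg_carrierE[of v]) (use v in auto)
    moreover from this have "f a \<oplus>\<^bsub>B\<^esub> j \<ominus>\<^bsub>B\<^esub> f a = j"
      using J.Icarr[of j] H.S.a_comm[of "f a" j] by (simp add: a_minus_def H.S.a_assoc H.S.r_neg)
    ultimately show ?thesis by (simp add: emb_def)
  qed
  show ?thesis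
  proof
    assume "koszul_H_nonzero ?RM (map emb xs) k"
    then show "koszul_H_nonzero ?AM xs k \<or> koszul_H_nonzero ?JM xs k"
      using koszul_H_nonzero_split[OF RM.module_axioms ex AM.module_axioms xs JM.module_axioms xs i i' p p' ip]
      by blast
  next
    assume "koszul_H_nonzero ?AM xs k \<or> koszul_H_nonzero ?JM xs k"
    then show "koszul_H_nonzero ?RM (map emb xs) k"
    proof
      assume "koszul_H_nonzero ?AM xs k"
      then show ?thesis
        by (rule koszul_H_nonzero_retract[OF RM.module_axioms ex AM.module_axioms xs i p, rotated]) (simp add: emb_def)
    next
      assume "koszul_H_nonzero ?JM xs k"
      then show ?thesis
        by (rule koszul_H_nonzero_retract[OF RM.module_axioms ex JM.module_axioms xs i' p', rotated])
          (simp add: a_minus_def J.Icarr H.S.minus_zero)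
    qed
  qed
qed

lemma Kgrade_list_amalg:
  assumes "set xs \<subseteq> carrier A"
  shows "Kgrade_list (self_module R) (map emb xs) =
    inf (Kgrade_list (self_module A) xs) (Kgrade_list (induced_module B f J) xs)"
  unfolding Kgrade_list_def koszul_H_nonzero_amalg_iff[OF assms]
  by (simp add: Collect_disj_eq image_Un Inf_union_distrib)

text \<open>I and the extension of its image along \<open>emb\<close> need not contain one another,
  so both inequalities trade generators only up to powers.\<close>

lemma Kgrade_amalg:
  assumes I: "ideal I R"
  shows "Kgrade (self_module R) I =
    inf (Kgrade (self_module A) (fst ` I)) (Kgrade (induced_module B f J) (fst ` I))"
    (is "_ = inf (Kgrade ?AM _) (Kgrade ?JM _)")
proof (rule antisym)
  interpret F: nil_surjection R A fst by (rule fst_nil_surjection)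
  interpret I: ideal I R by fact
  note mR = self_module_is_module[OF amalg_cring] and mA = self_module_is_module[OF H.R.is_cring]
    and mJ = induced_module_is_module
  have fstI: "fst ` I \<subseteq> carrier A" using F.hom_closed I.Icarr by auto
  show "Kgrade (self_module R) I \<le> inf (Kgrade ?AM (fst ` I)) (Kgrade ?JM (fst ` I))"
    unfolding Kgrade_def[of _ I]
  proof (rule SUP_least)
    fix xs assume "xs \<in> {xs. set xs \<subseteq> I}"
    then have xs: "set xs \<subseteq> I" "set xs \<subseteq> carrier R" using I.Icarr by auto
    let ?ys = "map fst xs"
    have ys: "set ?ys \<subseteq> fst ` I" "set ?ys \<subseteq> carrier A" using xs fstI by auto
    have yc: "set (map emb ?ys) \<subseteq> carrier R" using ys(2) emb_closed by auto
    have "Kgrade_list (self_module R) xs \<le> Kgrade_list (self_module R) (map emb ?ys)"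
    proof (rule Kgrade_list_radical[OF mR xs(2) yc])
      fix x assume x: "x \<in> set xs"
      have xR: "x \<in> carrier R" and eR: "emb (fst x) \<in> carrier R"
        using x xs(2) yc by auto
      have eq: "fst (emb (fst x)) = fst x" by (simp add: emb_def)
      obtain n :: nat and r where r: "r \<in> carrier R" "x [^]\<^bsub>R\<^esub> n = r \<otimes>\<^bsub>R\<^esub> emb (fst x)"
        using power_multiple_if_fst_eq[OF eR xR eq] by blast
      have "emb (fst x) \<in> Idl\<^bsub>R\<^esub> (set (map emb ?ys))"
        using F.R.genideal_self[OF yc] x by auto
      then have "r \<otimes>\<^bsub>R\<^esub> emb (fst x) \<in> Idl\<^bsub>R\<^esub> (set (map emb ?ys))"
        using r(1) ideal.I_l_closed[OF F.R.genideal_ideal[OF yc]] by blast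
      then show "\<exists>n::nat. x [^]\<^bsub>R\<^esub> n \<in> Idl\<^bsub>R\<^esub> (set (map emb ?ys))" using r(2) by metis
    qed
    also have "\<dots> = inf (Kgrade_list ?AM ?ys) (Kgrade_list ?JM ?ys)"
      by (rule Kgrade_list_amalg[OF ys(2)])
    also have "\<dots> \<le> inf (Kgrade ?AM (fst ` I)) (Kgrade ?JM (fst ` I))"
      unfolding Kgrade_def using ys(1) by (intro inf_mono SUP_upper) auto
    finally show "Kgrade_list (self_module R) xs \<le> inf (Kgrade ?AM (fst ` I)) (Kgrade ?JM (fst ` I))" .
  qed
  \<comment> \<open>The suprema for \<open>A\<close> and \<open>J\<close> may be approached along
    different lists. Distributivity gives one supremum over pairs, and the concatenation of a pair
    serves both modules.\<close>
  show "inf (Kgrade ?AM (fst ` I)) (Kgrade ?JM (fst ` I)) \<le> Kgrade (self_module R) I"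
    unfolding Kgrade_def[of _ "fst ` I"] SUP_inf_distrib2
  proof (intro SUP_least)
    fix xs ys assume "xs \<in> {xs. set xs \<subseteq> fst ` I}" "ys \<in> {ys. set ys \<subseteq> fst ` I}"
    then have xy: "set (xs @ ys) \<subseteq> fst ` I" by auto
    then have c: "set (xs @ ys) \<subseteq> carrier A" "set xs \<subseteq> carrier A" "set ys \<subseteq> carrier A" using fstI by auto
    have pow1: "\<exists>n::nat. x [^]\<^bsub>A\<^esub> n \<in> Idl\<^bsub>A\<^esub> (set (xs @ ys))" if "x \<in> set (xs @ ys)" for x
    proof -
      have "x \<in> carrier A" using that c(1) by blast
      then have "x [^]\<^bsub>A\<^esub> (1::nat) = x" by simp
      then show ?thesis using H.R.genideal_self[OF c(1)] that by (metis subsetD)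
    qed
    have "inf (Kgrade_list ?AM xs) (Kgrade_list ?JM ys) \<le> inf (Kgrade_list ?AM (xs @ ys)) (Kgrade_list ?JM (xs @ ys))"
      using pow1 by (intro inf_mono Kgrade_list_radical[OF mA c(2,1)] Kgrade_list_radical[OF mJ c(3,1)]) auto
    also have "\<dots> = Kgrade_list (self_module R) (map emb (xs @ ys))"
      using Kgrade_list_amalg[OF c(1)] by simp
    also have "\<dots> \<le> Kgrade (self_module R) I"
    proof -
      \<comment> \<open>emb x itself may lie outside I; a power of it lies in I because some u in I
        has first component x.\<close>
      have "\<exists>y\<in>I. \<exists>n::nat. emb x [^]\<^bsub>R\<^esub> n = y" if x: "x \<in> set (xs @ ys)" for x
      proof -
        obtain u where u: "u \<in> I" "x = fst u" using x xy by blast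
        have eR: "emb x \<in> carrier R" using x c(1) emb_closed by blast
        have eq: "fst u = fst (emb x)" using u(2) by (simp add: emb_def)
        obtain n :: nat and r where "r \<in> carrier R" "emb x [^]\<^bsub>R\<^esub> n = r \<otimes>\<^bsub>R\<^esub> u"
          using power_multiple_if_fst_eq[OF I.Icarr[OF u(1)] eR eq] by blast
        then show ?thesis using I.I_l_closed[OF u(1)] by blast
      qed
      then obtain g where g: "\<And>x. x \<in> set (xs @ ys) \<Longrightarrow> g x \<in> I"
        "\<And>x. x \<in> set (xs @ ys) \<Longrightarrow> \<exists>n::nat. emb x [^]\<^bsub>R\<^esub> n = g x" by metis
      let ?zs = "map g (xs @ ys)"
      have zs: "set ?zs \<subseteq> I" "set ?zs \<subseteq> carrier R" using g(1) I.Icarr by auto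
      have ec: "set (map emb (xs @ ys)) \<subseteq> carrier R" using c(1) emb_closed by auto
      have "Kgrade_list (self_module R) (map emb (xs @ ys)) \<le> Kgrade_list (self_module R) ?zs"
      proof (rule Kgrade_list_radical[OF mR ec zs(2)])
        fix w assume "w \<in> set (map emb (xs @ ys))"
        then obtain x where x: "x \<in> set (xs @ ys)" "w = emb x" by auto
        then obtain n :: nat where "w [^]\<^bsub>R\<^esub> n = g x" using g(2) by blast
        moreover have "g x \<in> Idl\<^bsub>R\<^esub> (set ?zs)" using F.R.genideal_self[OF zs(2)] x(1) by auto
        ultimately show "\<exists>n::nat. w [^]\<^bsub>R\<^esub> n \<in> Idl\<^bsub>R\<^esub> (set ?zs)" by metis
      qed
      also have "\<dots> \<le> Kgrade (self_module R) I"
        unfolding Kgrade_def using zs(1) by (intro SUP_upper) auto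
      finally show ?thesis .
    qed
    finally show "inf (Kgrade_list ?AM xs) (Kgrade_list ?JM ys) \<le> Kgrade (self_module R) I" .
  qed
qed

end

section \<open>The Cohen-Macaulay condition read off on the ideals of \<open>A\<close>\<close>

theorem theorem4p6:
  fixes A :: "'a ring" and B :: "'b ring" and f :: "'a \<Rightarrow> 'b" and J :: "'b set"
  assumes "cring A" and "cring B" and "f \<in> ring_hom A B"
    and "ideal J B" and "J \<subseteq> nilrad B"
  shows "CM_ideals (amalg A B f J) \<longleftrightarrow>
           CM_ideals A \<and>
           (\<forall>\<aa>. ideal \<aa> A \<longrightarrow> ht A \<aa> \<le> Kgrade (induced_module B f J) \<aa>)"
proof -
  interpret nil_amalgamation A B f J
    by (intro nil_amalgamation.intro amalgamation.intro nil_amalgamation_axioms.intro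
        ring_hom_cring.intro ring_hom_cring_axioms.intro assms)
  interpret F: nil_surjection R A fst by (rule fst_nil_surjection)
  let ?AM = "self_module A" and ?JM = "induced_module B f J"
  have "CM_ideals R \<longleftrightarrow> (\<forall>\<aa>. ideal \<aa> A \<longrightarrow> ht A \<aa> = inf (Kgrade ?AM \<aa>) (Kgrade ?JM \<aa>))" (is "_ \<longleftrightarrow> ?min")
  proof
    assume CM: "CM_ideals R"
    show ?min
    proof (intro allI impI)
      fix \<aa> assume a: "ideal \<aa> A"
      \<comment> \<open>The projection is onto, so the preimage of \<aa> has image \<aa> again:
        every ideal of \<open>A\<close> arises from one of the amalgamation.\<close>
      let ?I = "{r \<in> carrier R. fst r \<in> \<aa>}"
      have I: "ideal ?I R"
        by (rule ring_hom_ring.ideal_vimage[OF ring_hom_ringI2[OF F.R.ring_axioms H.R.ring_axioms F.homh] a])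
      have "fst ` ?I = \<aa>" using ideal.Icarr[OF a] by (intro F.image_vimage) auto
      then show "ht A \<aa> = inf (Kgrade ?AM \<aa>) (Kgrade ?JM \<aa>)"
        using CM I F.ht_image[OF I] Kgrade_amalg[OF I] by (simp add: CM_ideals_def)
    qed
  next
    assume ?min
    then show "CM_ideals R"
      unfolding CM_ideals_def using F.ht_image Kgrade_amalg F.image_ideal by simp
  qed
  also have "\<dots> \<longleftrightarrow> CM_ideals A \<and> (\<forall>\<aa>. ideal \<aa> A \<longrightarrow> ht A \<aa> \<le> Kgrade ?JM \<aa>)"
  proof -
    \<comment> \<open>Since the grade on \<open>A\<close> never exceeds the height, a minimum equal
      to the height must be attained by that grade.\<close>
    have "ht A \<aa> = inf (Kgrade ?AM \<aa>) (Kgrade ?JM \<aa>) \<longleftrightarrow>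
        ht A \<aa> = Kgrade ?AM \<aa> \<and> ht A \<aa> \<le> Kgrade ?JM \<aa>" for \<aa>
      using Kgrade_le_ht[of A \<aa>] by (auto simp: inf_min min_def)
    then show ?thesis by (auto simp: CM_ideals_def)
  qed
  finally show ?thesis .
qed

end
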